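(* Let $\mathcal M=(\mathcal C,D,\mathtt{app},\mathtt{lam},(\bar c_i)_{i=1}^n,\mathtt{fail},\mathtt{case})$ be a $\lambda_C$-model. For any $\lambda_C$-terms $t,t'$ whose free variables are all in a list $\Gamma=x_1,\dots,x_k$ of distinct variables, $$t\equiv_{\lambda_C} t' \quad\Longrightarrow\quad [\![t]\!]_\Gamma=[\![t']\!]_\Gamma .$$
   Context: The lambda calculus with constructors ($\lambda_C$). Fix a finite set of constructors $\{c_1,\dots,c_n\}$ (constants, distinct from variables, not subject to substitution). Terms are given by $t,u::=x\mid t\,u\mid \lambda x.t\mid c\mid \{\theta\}\cdot t$, where a case-binding $\theta=\{d_1\mapsto u_1;\dots;d_k\mapsto u_k\}$ ($k\ge 0$, the $d_j$ pairwise distinct constructors) is a finite partial function from constructors to terms with domain $\mathrm{dom}(\theta)=\{d_1,\dots,d_k\}$. Terms are considered up to $\alpha$-conversion. Composition of case-bindings: $\theta\circ\{d_1\mapsto t_1;\dots;d_k\mapsto t_k\}=\{d_1\mapsto \{\theta\}\cdot t_1;\dots;d_k\mapsto\{\theta\}\cdot t_k\}$. One-step reduction $\to$ is the contextual closure (also inside case-bindings) of the six rules: (AppLam) $(\lambda x.t)u\to t[x:=u]$; (LamApp) $\lambda x.t\,x\to t$ if $x\notin FV(t)$; (CaseCons) $\{\theta\}\cdot c\to t$ if $(c\mapsto t)\in\theta$; (CaseApp) $\{\theta\}\cdot(t\,u)\to(\{\theta\}\cdot t)\,u$; (CaseLam) $\{\theta\}\cdot\lambda x.t\to\lambda x.\{\theta\}\cdot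 t$ if $x\notin FV(\theta)$; (CaseCase) $\{\theta\}\cdot\{\phi\}\cdot t\to\{\theta\circ\phi\}\cdot t$. $\equiv_{\lambda_C}$ is the reflexive, symmetric, transitive closure of $\to$. Categorical notation: in a cartesian closed category, composition is written in diagrammatic order $f;g$ (first $f$, then $g$); $\langle f,g\rangle$ is pairing, $\pi^k_i$ the $i$-th projection of a $k$-ary product ($\pi_i=\pi^2_i$), $!_A:A\to 1$ the unique map to the terminal object, $D^k$ the $k$-fold product, $B^A$ the exponential, $\mathrm{ev}:B^A\times A\to B$ evaluation, $\Lambda(f):C\to B^A$ the currying of $f:C\times A\to B$; $\alpha$ denotes canonical associativity isomorphisms $(A\times B)\times C\to A\times(B\times C)$. A $\lambda_C$-model is a tuple $(\mathcal C,D,\mathtt{app},\mathtt{lam},(\bar c_i)_{i=1}^n,\mathtt{fail},\mathtt{case})$ with $\mathcal C$ cartesian closed, $D$ an object, $\bar c_i,\mathtt{fail}:1\to D$, $\mathtt{app}:D\to D^D$, $\mathtt{lam}:D^D\to D$, $\mathtt{case}:D^n\times D\to D$, such that, with $\widehat{\mathtt{case}}=\Lambda(\alpha;(\mathrm{id}_{D^n}\times\mathrm{ev});\mathtt{case}):D^n\times D^D\to D^D$ and $\mathtt{comp}=\langle(\mathrm{id}_{D^n}\times\pi^n_1);\mathtt{case},\dots,(\mathrm{id}_{D^n}\times\pi^n_n);\mathtt{case}\rangle:D^n\times D^n\to D^n$: (D1) $\mathtt{lam};\mathtt{app}=\mathrm{id}_{D^D}$ and $\mathtt{app};\mathtt{lam}=\mathrm{id}_D$;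 (D2) for every $i\in\{1,\dots,n\}$, $\langle\mathrm{id}_{D^n},!_{D^n}\rangle;(\mathrm{id}_{D^n}\times\bar c_i);\mathtt{case}=\pi^n_i$; (D3) $(\mathtt{case}\times\mathrm{id}_D);(\mathtt{app}\times\mathrm{id}_D);\mathrm{ev}=\alpha;(\mathrm{id}_{D^n}\times(\mathtt{app}\times\mathrm{id}_D));(\mathrm{id}_{D^n}\times\mathrm{ev});\mathtt{case}$ as maps $(D^n\times D)\times D\to D$; (D4) $\widehat{\mathtt{case}};\mathtt{lam}=(\mathrm{id}_{D^n}\times\mathtt{lam});\mathtt{case}$; (D5) $(\mathtt{comp}\times\mathrm{id}_D);\mathtt{case}=\alpha;(\mathrm{id}_{D^n}\times\mathtt{case});\mathtt{case}$ as maps $(D^n\times D^n)\times D\to D$; (D6) $(\mathrm{id}_{D^n}\times\mathtt{fail});\mathtt{case}=\pi_2;\mathtt{fail}$ as maps $D^n\times 1\to D$. Interpretation: for $\Gamma=x_1,\dots,x_k$ containing the free variables, $[\![t]\!]_\Gamma:D^k\to D$ and for case-bindings $[\![\theta]\!]_\Gamma:D^k\to D^n$ are defined by: $[\![x_i]\!]_\Gamma=\pi^k_i$; $[\![t\,u]\!]_\Gamma=\langle[\![t]\!]_\Gamma,[\![u]\!]_\Gamma\rangle;(\mathtt{app}\times\mathrm{id}_D);\mathrm{ev}$; $[\![\lambda x_{k+1}.t]\!]_\Gamma=\Lambda(f_t);\mathtt{lam}$ (bound variable renamed so $x_{k+1}\notin\Gamma$), where $f_t:D^k\times D\to D$ is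 the canonical iso $D^k\times D\cong D^{k+1}$ followed by $[\![t]\!]_{\Gamma,x_{k+1}}$; $[\![c_i]\!]_\Gamma=!_{D^k};\bar c_i$; $[\![\{\theta\}\cdot t]\!]_\Gamma=\langle[\![\theta]\!]_\Gamma,[\![t]\!]_\Gamma\rangle;\mathtt{case}$; $[\![\theta]\!]_\Gamma=\langle f_1,\dots,f_n\rangle$ with $f_i=[\![u_i]\!]_\Gamma$ if $(c_i\mapsto u_i)\in\theta$ and $f_i=!_{D^k};\mathtt{fail}$ if $c_i\notin\mathrm{dom}(\theta)$. *)

theory Defs
  imports "HOL-Library.Finite_Map"
begin

type_synonym var = nat

text \<open>
  Raw terms with named bound variables. The constructor \<open>c\<^sub>i\<close> (\<open>1 \<le> i \<le> n\<close>) of the calculus is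
  \<open>Con (i - 1)\<close>; the terms over \<open>n\<close> constructors are carved out by \<open>lc_terms n\<close> below.
  Terms are not quotiented by \<open>\<alpha>\<close>-conversion: it is instead included in the
  congruence \<open>lc_conv\<close>.
\<close>

datatype trm =
    Var var
  | App trm trm
  | Lam var trm
  | Con nat
  | Case "(nat, trm) fmap" trm

type_synonym case_binding = "(nat, trm) fmap"

primrec FV :: "trm \<Rightarrow> var set" where
  "FV (Var x) = {x}"
| "FV (App t u) = FV t \<union> FV u"
| "FV (Lam x t) = FV t - {x}"
| "FV (Con c) = {}"
| "FV (Case \<theta> t) = \<Union> (fmran' (fmmap FV \<theta>)) \<union> FV t"

definition FV_cb :: "case_binding \<Rightarrow> var set" where
  "FV_cb \<theta> = (\<Union>u \<in> fmran' \<theta>. FV u)"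

primrec constrs :: "trm \<Rightarrow> nat set" where
  "constrs (Var x) = {}"
| "constrs (App t u) = constrs t \<union> constrs u"
| "constrs (Lam x t) = constrs t"
| "constrs (Con c) = {c}"
| "constrs (Case \<theta> t) = fmdom' \<theta> \<union> \<Union> (fmran' (fmmap constrs \<theta>)) \<union> constrs t"

definition lc_terms :: "nat \<Rightarrow> trm set" where
  "lc_terms n = {t. constrs t \<subseteq> {..<n}}"

text \<open>\<open>variant y X\<close> is \<open>y\<close> itself unless \<open>y \<in> X\<close>, and then some variable outside
  the finite set \<open>X\<close>.\<close>

definition variant :: "var \<Rightarrow> var set \<Rightarrow> var" where
  "variant y X = (if y \<in> X then LEAST z. z \<notin> X else y)"

text \<open>Capture-avoiding simultaneous substitution; a bound variable is renamed exactly when it would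
  capture a free variable of a substituted term.\<close>

primrec msubst :: "trm \<Rightarrow> (var \<Rightarrow> trm) \<Rightarrow> trm" where
  "msubst (Var x) \<sigma> = \<sigma> x"
| "msubst (App t u) \<sigma> = App (msubst t \<sigma>) (msubst u \<sigma>)"
| "msubst (Lam y t) \<sigma> =
     (let z = variant y (\<Union>v \<in> FV t - {y}. FV (\<sigma> v)) in Lam z (msubst t (\<sigma>(y := Var z))))"
| "msubst (Con c) \<sigma> = Con c"
| "msubst (Case \<theta> t) \<sigma> = Case (fmmap (\<lambda>u. msubst u \<sigma>) \<theta>) (msubst t \<sigma>)"

definition subst :: "trm \<Rightarrow> var \<Rightarrow> trm \<Rightarrow> trm"  ("_[_ ::= _]" [1000, 0, 0] 1000) where
  "t[x ::= u] = msubst t (Var(x := u))"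

definition cb_comp :: "case_binding \<Rightarrow> case_binding \<Rightarrow> case_binding"  (infixl "\<circ>\<^sub>c" 55) where
  "\<theta> \<circ>\<^sub>c \<phi> = fmmap (Case \<theta>) \<phi>"

inductive ctxt_closure :: "(trm \<Rightarrow> trm \<Rightarrow> bool) \<Rightarrow> trm \<Rightarrow> trm \<Rightarrow> bool"
  for R :: "trm \<Rightarrow> trm \<Rightarrow> bool" where
  root: "R t t' \<Longrightarrow> ctxt_closure R t t'"
| appL: "ctxt_closure R t t' \<Longrightarrow> ctxt_closure R (App t u) (App t' u)"
| appR: "ctxt_closure R u u' \<Longrightarrow> ctxt_closure R (App t u) (App t u')"
| lam: "ctxt_closure R t t' \<Longrightarrow> ctxt_closure R (Lam x t) (Lam x t')"
| case_arg: "ctxt_closure R t t' \<Longrightarrow> ctxt_closure R (Case \<theta> t) (Case \<theta> t')"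
| case_binding: "fmlookup \<theta> c = Some u \<Longrightarrow> ctxt_closure R u u' \<Longrightarrow>
    ctxt_closure R (Case \<theta> t) (Case (fmupd c u' \<theta>) t)"

inductive lc_rule :: "trm \<Rightarrow> trm \<Rightarrow> bool" where
  AppLam: "lc_rule (App (Lam x t) u) (t[x ::= u])"
| LamApp: "x \<notin> FV t \<Longrightarrow> lc_rule (Lam x (App t (Var x))) t"
| CaseCons: "fmlookup \<theta> c = Some t \<Longrightarrow> lc_rule (Case \<theta> (Con c)) t"
| CaseApp: "lc_rule (Case \<theta> (App t u)) (App (Case \<theta> t) u)"
| CaseLam: "x \<notin> FV_cb \<theta> \<Longrightarrow> lc_rule (Case \<theta> (Lam x t)) (Lam x (Case \<theta> t))"
| CaseCase: "lc_rule (Case \<theta> (Case \<phi> t)) (Case (\<theta> \<circ>\<^sub>c \<phi>) t)"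

inductive alpha_rule :: "trm \<Rightarrow> trm \<Rightarrow> bool" where
  "y \<notin> FV t \<Longrightarrow> alpha_rule (Lam x t) (Lam y (t[x ::= Var y]))"

definition lc_red :: "trm \<Rightarrow> trm \<Rightarrow> bool" where
  "lc_red = ctxt_closure lc_rule"

definition alpha_step :: "trm \<Rightarrow> trm \<Rightarrow> bool" where
  "alpha_step = ctxt_closure alpha_rule"

text \<open>All intermediate terms are required to be terms over the \<open>n\<close> constructors.\<close>

definition lc_conv :: "nat \<Rightarrow> trm \<Rightarrow> trm \<Rightarrow> bool" where
  "lc_conv n = equivclp (\<lambda>t u. t \<in> lc_terms n \<and> u \<in> lc_terms n \<and> (lc_red t u \<or> alpha_step t u))"

text \<open>
  Composition \<open>f ;; g\<close> is in diagrammatic order. A chosen product is given for every finite list of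
  objects, so that \<open>Prod []\<close> is the terminal object; no relation between products of different
  lists is assumed. \<open>Exp A B\<close> is \<open>B\<^sup>A\<close>. Projections are numbered from 0.
\<close>

record ('o, 'a) ccc =
  Obj :: "'o set"
  Arr :: "'a set"
  Dom :: "'a \<Rightarrow> 'o"
  Cod :: "'a \<Rightarrow> 'o"
  ident :: "'o \<Rightarrow> 'a"
  seq :: "'a \<Rightarrow> 'a \<Rightarrow> 'a"  (infixl ";;\<index>" 70)
  Prod :: "'o list \<Rightarrow> 'o"
  proj :: "'o list \<Rightarrow> nat \<Rightarrow> 'a"
  Exp :: "'o \<Rightarrow> 'o \<Rightarrow> 'o"
  ev :: "'o \<Rightarrow> 'o \<Rightarrow> 'a"

definition hom :: "('o, 'a, 'm) ccc_scheme \<Rightarrow> 'o \<Rightarrow> 'o \<Rightarrow> 'a set" where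
  "hom C A B = {f \<in> Arr C. Dom C f = A \<and> Cod C f = B}"

locale category =
  fixes C :: "('o, 'a, 'm) ccc_scheme" (structure)
  assumes Dom_Obj: "f \<in> Arr C \<Longrightarrow> Dom C f \<in> Obj C"
    and Cod_Obj: "f \<in> Arr C \<Longrightarrow> Cod C f \<in> Obj C"
    and Id_hom: "A \<in> Obj C \<Longrightarrow> ident C A \<in> hom C A A"
    and seq_hom: "f \<in> hom C A B \<Longrightarrow> g \<in> hom C B E \<Longrightarrow> f ;; g \<in> hom C A E"
    and Id_left: "f \<in> hom C A B \<Longrightarrow> ident C A ;; f = f"
    and Id_right: "f \<in> hom C A B \<Longrightarrow> f ;; ident C B = f"
    and seq_assoc: "f \<in> hom C A B \<Longrightarrow> g \<in> hom C B E \<Longrightarrow> h \<in> hom C E F \<Longrightarrow>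
          (f ;; g) ;; h = f ;; (g ;; h)"

text \<open>\<open>tuple C X [f\<^sub>1, \<dots>, f\<^sub>k]\<close> is \<open>\<langle>f\<^sub>1, \<dots>, f\<^sub>k\<rangle>\<close> out of \<open>X\<close>; the object \<open>X\<close> is needed for \<open>k = 0\<close>,
  where the result is the unique arrow from \<open>X\<close> to the terminal object.\<close>

definition tuple :: "('o, 'a, 'm) ccc_scheme \<Rightarrow> 'o \<Rightarrow> 'a list \<Rightarrow> 'a" where
  "tuple C X fs = (THE h. h \<in> hom C X (Prod C (map (Cod C) fs)) \<and>
     (\<forall>i < length fs. h ;;\<^bsub>C\<^esub> proj C (map (Cod C) fs) i = fs ! i))"

definition one :: "('o, 'a, 'm) ccc_scheme \<Rightarrow> 'o" where
  "one C = Prod C []"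

definition bang :: "('o, 'a, 'm) ccc_scheme \<Rightarrow> 'o \<Rightarrow> 'a" where
  "bang C X = tuple C X []"

definition prod2 :: "('o, 'a, 'm) ccc_scheme \<Rightarrow> 'o \<Rightarrow> 'o \<Rightarrow> 'o" where
  "prod2 C A B = Prod C [A, B]"

definition fst2 :: "('o, 'a, 'm) ccc_scheme \<Rightarrow> 'o \<Rightarrow> 'o \<Rightarrow> 'a" where
  "fst2 C A B = proj C [A, B] 0"

definition snd2 :: "('o, 'a, 'm) ccc_scheme \<Rightarrow> 'o \<Rightarrow> 'o \<Rightarrow> 'a" where
  "snd2 C A B = proj C [A, B] 1"

definition pair :: "('o, 'a, 'm) ccc_scheme \<Rightarrow> 'a \<Rightarrow> 'a \<Rightarrow> 'a" where
  "pair C f g = tuple C (Dom C f) [f, g]"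

definition cross :: "('o, 'a, 'm) ccc_scheme \<Rightarrow> 'a \<Rightarrow> 'a \<Rightarrow> 'a" where
  "cross C f g = pair C (fst2 C (Dom C f) (Dom C g) ;;\<^bsub>C\<^esub> f) (snd2 C (Dom C f) (Dom C g) ;;\<^bsub>C\<^esub> g)"

definition assoc :: "('o, 'a, 'm) ccc_scheme \<Rightarrow> 'o \<Rightarrow> 'o \<Rightarrow> 'o \<Rightarrow> 'a" where
  "assoc C A B E =
     pair C (fst2 C (prod2 C A B) E ;;\<^bsub>C\<^esub> fst2 C A B)
       (pair C (fst2 C (prod2 C A B) E ;;\<^bsub>C\<^esub> snd2 C A B) (snd2 C (prod2 C A B) E))"

definition pow :: "('o, 'a, 'm) ccc_scheme \<Rightarrow> 'o \<Rightarrow> nat \<Rightarrow> 'o" where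
  "pow C A k = Prod C (replicate k A)"

definition pow_proj :: "('o, 'a, 'm) ccc_scheme \<Rightarrow> 'o \<Rightarrow> nat \<Rightarrow> nat \<Rightarrow> 'a" where
  "pow_proj C A k i = proj C (replicate k A) i"

text \<open>The canonical isomorphism \<open>A\<^sup>k \<times> A \<cong> A\<^sup>k\<^sup>+\<^sup>1\<close>.\<close>

definition pow_snoc :: "('o, 'a, 'm) ccc_scheme \<Rightarrow> 'o \<Rightarrow> nat \<Rightarrow> 'a" where
  "pow_snoc C A k = tuple C (prod2 C (pow C A k) A)
     (map (\<lambda>i. fst2 C (pow C A k) A ;;\<^bsub>C\<^esub> pow_proj C A k i) [0..<k] @ [snd2 C (pow C A k) A])"

text \<open>\<open>Curry C X A f\<close> is \<open>\<Lambda>(f)\<close> for \<open>f : X \<times> A \<rightarrow> B\<close>.\<close>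

definition Curry :: "('o, 'a, 'm) ccc_scheme \<Rightarrow> 'o \<Rightarrow> 'o \<Rightarrow> 'a \<Rightarrow> 'a" where
  "Curry C X A f = (THE h. h \<in> hom C X (Exp C A (Cod C f)) \<and>
     cross C h (ident C A) ;;\<^bsub>C\<^esub> ev C A (Cod C f) = f)"

locale cartesian_closed = category C
  for C :: "('o, 'a, 'm) ccc_scheme" (structure) +
  assumes Prod_Obj: "set As \<subseteq> Obj C \<Longrightarrow> Prod C As \<in> Obj C"
    and proj_hom: "set As \<subseteq> Obj C \<Longrightarrow> i < length As \<Longrightarrow> proj C As i \<in> hom C (Prod C As) (As ! i)"
    and Prod_universal: "set As \<subseteq> Obj C \<Longrightarrow> X \<in> Obj C \<Longrightarrow> length fs = length As \<Longrightarrow>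
          (\<forall>i < length As. fs ! i \<in> hom C X (As ! i)) \<Longrightarrow>
          \<exists>!h. h \<in> hom C X (Prod C As) \<and> (\<forall>i < length As. h ;; proj C As i = fs ! i)"
    and Exp_Obj: "A \<in> Obj C \<Longrightarrow> B \<in> Obj C \<Longrightarrow> Exp C A B \<in> Obj C"
    and ev_hom: "A \<in> Obj C \<Longrightarrow> B \<in> Obj C \<Longrightarrow> ev C A B \<in> hom C (prod2 C (Exp C A B) A) B"
    and Exp_universal: "A \<in> Obj C \<Longrightarrow> B \<in> Obj C \<Longrightarrow> X \<in> Obj C \<Longrightarrow> f \<in> hom C (prod2 C X A) B \<Longrightarrow>
          \<exists>!h. h \<in> hom C X (Exp C A B) \<and> cross C h (ident C A) ;; ev C A B = f"

text \<open>The arrows \<open>conM M i\<close> are only meaningful for \<open>i < ncon M\<close>.\<close>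

record ('o, 'a) lc_model = "('o, 'a) ccc" +
  ncon :: nat
  carD :: 'o
  appM :: 'a
  lamM :: 'a
  conM :: "nat \<Rightarrow> 'a"
  failM :: 'a
  caseM :: 'a

definition caseHat :: "('o, 'a, 'm) lc_model_scheme \<Rightarrow> 'a" where
  "caseHat M = (let D = carD M; Dn = pow M D (ncon M); DD = Exp M D D in
     Curry M (prod2 M Dn DD) D
       (assoc M Dn DD D ;;\<^bsub>M\<^esub> cross M (ident M Dn) (ev M D D) ;;\<^bsub>M\<^esub> caseM M))"

definition compM :: "('o, 'a, 'm) lc_model_scheme \<Rightarrow> 'a" where
  "compM M = (let D = carD M; n = ncon M; Dn = pow M D n in
     tuple M (prod2 M Dn Dn)
       (map (\<lambda>i. cross M (ident M Dn) (pow_proj M D n i) ;;\<^bsub>M\<^esub> caseM M) [0..<n]))"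

locale lambdaC_model = cartesian_closed M
  for M :: "('o, 'a, 'm) lc_model_scheme" (structure) +
  fixes D Dn DD n
  defines "D \<equiv> carD M" and "n \<equiv> ncon M" and "Dn \<equiv> pow M D n" and "DD \<equiv> Exp M D D"
  assumes D_Obj: "D \<in> Obj M"
    and app_hom: "appM M \<in> hom M D DD"
    and lam_hom: "lamM M \<in> hom M DD D"
    and con_hom: "i < n \<Longrightarrow> conM M i \<in> hom M (one M) D"
    and fail_hom: "failM M \<in> hom M (one M) D"
    and case_hom: "caseM M \<in> hom M (prod2 M Dn D) D"
    and D1: "lamM M ;; appM M = ident M DD" "appM M ;; lamM M = ident M D"
    and D2: "i < n \<Longrightarrow>
          pair M (ident M Dn) (bang M Dn) ;; cross M (ident M Dn) (conM M i) ;; caseM M = pow_proj M D n i"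
    and D3: "cross M (caseM M) (ident M D) ;; cross M (appM M) (ident M D) ;; ev M D D =
          assoc M Dn D D ;; cross M (ident M Dn) (cross M (appM M) (ident M D))
            ;; cross M (ident M Dn) (ev M D D) ;; caseM M"
    and D4: "caseHat M ;; lamM M = cross M (ident M Dn) (lamM M) ;; caseM M"
    and D5: "cross M (compM M) (ident M D) ;; caseM M =
          assoc M Dn Dn D ;; cross M (ident M Dn) (caseM M) ;; caseM M"
    and D6: "cross M (ident M Dn) (failM M) ;; caseM M = snd2 M Dn (one M) ;; failM M"

lemma fset_of_fmap_lookup: "p \<in> fset (fset_of_fmap \<theta>) \<longleftrightarrow> fmlookup \<theta> (fst p) = Some (snd p)"
  by (metis fset_of_fmap_iff prod.collapse)

lemma size_case_binding:
  "size (Case \<theta> t) = (\<Sum>p \<in> fset (fset_of_fmap \<theta>). Suc (size (snd p))) + size t + 1"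
  by (simp add: case_prod_unfold)

lemma size_fmlookup:
  assumes "fmlookup \<theta> c = Some u"
  shows "size u < size (Case \<theta> t)"
proof -
  have "(c, u) \<in> fset (fset_of_fmap \<theta>)"
    using assms by (simp add: fset_of_fmap_lookup)
  then have "Suc (size (snd (c, u))) \<le> (\<Sum>p \<in> fset (fset_of_fmap \<theta>). Suc (size (snd p)))"
    by (intro member_le_sum) auto
  then show ?thesis
    by (simp add: size_case_binding del: trm.size)
qed

lemma size_case_arg: "size t < size (Case \<theta> t)"
  by (simp add: size_case_binding del: trm.size)

lemma size_fmmap:
  assumes "\<And>u. u \<in> fmran' \<theta> \<Longrightarrow> size (f u) = size (u :: trm)"
  shows "(\<Sum>p \<in> fset (fset_of_fmap (fmmap f \<theta>)). Suc (size (snd p)))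
       = (\<Sum>p \<in> fset (fset_of_fmap \<theta>). Suc (size (snd p)))"
proof -
  have inj: "inj_on (\<lambda>(k, v). (k, f v)) (fset (fset_of_fmap \<theta>))"
    by (auto simp: inj_on_def fset_of_fmap_lookup)
  show ?thesis
    unfolding fmmap_fset_of_fmap fimage.rep_eq sum.reindex[OF inj]
    by (rule sum.cong) (auto simp: fset_of_fmap_lookup intro!: assms fmran'I)
qed

lemma size_msubst_rename: "size (msubst t (\<lambda>v. Var (r v))) = size t"
proof (induction t arbitrary: r)
  case (Lam y t)
  have upd: "(\<lambda>v. Var (r v))(y := Var z) = (\<lambda>v. Var ((r(y := z)) v))" for z
    by auto
  show ?case
    unfolding msubst.simps Let_def upd by (simp add: Lam.IH del: fun_upd_apply)
next
  case (Case \<theta> t)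
  then show ?case
    by (simp add: size_case_binding size_fmmap del: trm.size(10))
qed auto

lemma size_subst_Var: "size (t[x ::= Var y]) = size t"
proof -
  have "Var(x := Var y) = (\<lambda>v. Var ((id(x := y)) v))"
    by auto
  then show ?thesis
    unfolding subst_def using size_msubst_rename by metis
qed

function interp :: "('o, 'a, 'm) lc_model_scheme \<Rightarrow> trm \<Rightarrow> var list \<Rightarrow> 'a" where
  "interp M (Var x) \<Gamma> =
     pow_proj M (carD M) (length \<Gamma>) (THE i. i < length \<Gamma> \<and> \<Gamma> ! i = x)"
| "interp M (App t u) \<Gamma> =
     pair M (interp M t \<Gamma>) (interp M u \<Gamma>)
       ;;\<^bsub>M\<^esub> cross M (appM M) (ident M (carD M)) ;;\<^bsub>M\<^esub> ev M (carD M) (carD M)"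
| "interp M (Lam x t) \<Gamma> =
     (let D = carD M; k = length \<Gamma>; y = variant x (set \<Gamma> \<union> FV (Lam x t)) in
      Curry M (pow M D k) D
        (pow_snoc M D k ;;\<^bsub>M\<^esub> interp M (t[x ::= Var y]) (\<Gamma> @ [y])) ;;\<^bsub>M\<^esub> lamM M)"
| "interp M (Con c) \<Gamma> = bang M (pow M (carD M) (length \<Gamma>)) ;;\<^bsub>M\<^esub> conM M c"
| "interp M (Case \<theta> t) \<Gamma> =
     (let Dk = pow M (carD M) (length \<Gamma>) in
      pair M
        (tuple M Dk
          (map (\<lambda>i. case fmlookup \<theta> i of
                      Some u \<Rightarrow> interp M u \<Gamma>
                    | None \<Rightarrow> bang M Dk ;;\<^bsub>M\<^esub> failM M) [0..<ncon M]))
        (interp M t \<Gamma>) ;;\<^bsub>M\<^esub> caseM M)"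
  by pat_completeness auto
termination
  by (relation "measure (\<lambda>(M, t, \<Gamma>). size t)") (auto simp: size_subst_Var size_fmlookup size_case_arg simp del: trm.size(10))

end

theory Submission
  imports Defs
begin

text \<open>
  A term is read as an arrow \<open>X \<rightarrow> D\<close> under a valuation sending each variable to an arrow \<open>X \<rightarrow> D\<close>.
  This reading is natural in \<open>X\<close>, depends only on the values of the free variables and turns
  substitution into update of the valuation, so each reduction rule becomes one model equation
  precomposed with a tuple: AppLam and LamApp use (D1), CaseCons (D2), CaseApp (D3), CaseLam (D4),
  and CaseCase (D5) together with (D6) for the constructors outside the inner case-binding.
  The interpretation in a context \<open>\<Gamma>\<close> is the reading at \<open>D\<^sup>k\<close> under the projections, the variables
  outside \<open>\<Gamma>\<close> being sent to failure.
\<close>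

subsection \<open>Equational reasoning in cartesian closed categories\<close>

context category
begin

text \<open>Typing by \<open>Arr\<close>, \<open>Dom\<close> and \<open>Cod\<close> instead of hom-sets keeps the side conditions of all
  rewrite rules below free of schematic objects, so that the simplifier can discharge them.\<close>

lemma seq_Arr [simp]:
  assumes "f \<in> Arr C" "g \<in> Arr C" "Cod C f = Dom C g"
  shows "f ;; g \<in> Arr C" "Dom C (f ;; g) = Dom C f" "Cod C (f ;; g) = Cod C g"
  using seq_hom[of f "Dom C f" "Cod C f" g "Cod C g"] assms by (auto simp: hom_def)

lemma ident_Arr [simp]:
  assumes "A \<in> Obj C"
  shows "ident C A \<in> Arr C" "Dom C (ident C A) = A" "Cod C (ident C A) = A"
  using Id_hom[OF assms] by (auto simp: hom_def)

lemma ident_seq [simp]: "f \<in> Arr C \<Longrightarrow> A = Dom C f \<Longrightarrow> ident C A ;; f = f"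
  using Id_left[of f "Dom C f" "Cod C f"] by (auto simp: hom_def)

lemma seq_ident [simp]: "f \<in> Arr C \<Longrightarrow> A = Cod C f \<Longrightarrow> f ;; ident C A = f"
  using Id_right[of f "Dom C f" "Cod C f"] by (auto simp: hom_def)

lemma seq_seq [simp]:
  assumes "f \<in> Arr C" "g \<in> Arr C" "h \<in> Arr C" "Cod C f = Dom C g" "Cod C g = Dom C h"
  shows "f ;; g ;; h = f ;; (g ;; h)"
  using seq_assoc[of f "Dom C f" "Cod C f" g "Cod C g" h "Cod C h"] assms by (auto simp: hom_def)

text \<open>With \<open>seq_seq\<close> as a rewrite rule composites nest to the right, so
  \<open>f ;; g\<close> is no longer a subterm once another arrow follows. Extending an equation by
  a tail \<open>k\<close> restores rewriting there and yields most of the \<open>_seq\<close>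
  variants below.\<close>

lemma seq_cong_right:
  assumes "f ;; g = h" "f \<in> Arr C" "g \<in> Arr C" "k \<in> Arr C" "Cod C f = Dom C g" "Cod C g = Dom C k"
  shows "f ;; (g ;; k) = h ;; k"
  using seq_seq[of f g k] assms by simp

declare Dom_Obj [simp] Cod_Obj [simp]

end

context cartesian_closed
begin

lemma tuple_Arr:
  assumes "X \<in> Obj C" "\<And>f. f \<in> set fs \<Longrightarrow> f \<in> Arr C \<and> Dom C f = X"
  shows "tuple C X fs \<in> Arr C" "Dom C (tuple C X fs) = X"
    "Cod C (tuple C X fs) = Prod C (map (Cod C) fs)"
    and tuple_proj: "\<And>i. i < length fs \<Longrightarrow> tuple C X fs ;; proj C (map (Cod C) fs) i = fs ! i"
proof -
  have "\<exists>!h. h \<in> hom C X (Prod C (map (Cod C) fs)) \<and>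
      (\<forall>i < length (map (Cod C) fs). h ;; proj C (map (Cod C) fs) i = fs ! i)"
    by (rule Prod_universal) (use assms in \<open>auto simp: hom_def\<close>)
  then have "tuple C X fs \<in> hom C X (Prod C (map (Cod C) fs)) \<and>
      (\<forall>i < length fs. tuple C X fs ;; proj C (map (Cod C) fs) i = fs ! i)"
    unfolding tuple_def length_map by (rule theI')
  then show "tuple C X fs \<in> Arr C" "Dom C (tuple C X fs) = X"
    "Cod C (tuple C X fs) = Prod C (map (Cod C) fs)"
    "\<And>i. i < length fs \<Longrightarrow> tuple C X fs ;; proj C (map (Cod C) fs) i = fs ! i"
    by (auto simp: hom_def)
qed

lemma proj_Arr:
  assumes "set As \<subseteq> Obj C" "i < length As"
  shows "proj C As i \<in> Arr C" "Dom C (proj C As i) = Prod C As" "Cod C (proj C As i) = As ! i"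
  using proj_hom[OF assms] by (auto simp: hom_def)

text \<open>The uniqueness half of the universal property, taken for the family of components of
  \<open>h'\<close>: both \<open>h\<close> and \<open>h'\<close> mediate for it.\<close>

lemma Prod_eqI:
  assumes "set As \<subseteq> Obj C" "h \<in> Arr C" "h' \<in> Arr C" "Dom C h = Dom C h'"
    "Cod C h = Prod C As" "Cod C h' = Prod C As"
    "\<And>i. i < length As \<Longrightarrow> h ;; proj C As i = h' ;; proj C As i"
  shows "h = h'"
proof -
  have "\<exists>!k. k \<in> hom C (Dom C h) (Prod C As) \<and>
      (\<forall>i < length As. k ;; proj C As i = map (\<lambda>i. h' ;; proj C As i) [0..<length As] ! i)"
    by (rule Prod_universal) (use assms in \<open>auto simp: hom_def proj_Arr\<close>)
  then show ?thesis
    using assms by (auto simp: hom_def)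
qed

section \<open>Terminal object and powers\<close>

lemma one_Obj [simp]: "one C \<in> Obj C"
  unfolding one_def by (rule Prod_Obj) simp

lemma prod2_Obj [simp]: "A \<in> Obj C \<Longrightarrow> B \<in> Obj C \<Longrightarrow> prod2 C A B \<in> Obj C"
  unfolding prod2_def by (rule Prod_Obj) simp

lemma pow_Obj [simp]: "A \<in> Obj C \<Longrightarrow> pow C A k \<in> Obj C"
  unfolding pow_def by (rule Prod_Obj) auto

declare Exp_Obj [simp]

lemma bang_Arr [simp]:
  assumes "X \<in> Obj C"
  shows "bang C X \<in> Arr C" "Dom C (bang C X) = X" "Cod C (bang C X) = one C"
  using assms tuple_Arr[of X "[]"] by (auto simp: bang_def one_def)

text \<open>The terminal object is the empty product, so \<open>Prod_eqI\<close> has no components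
  to compare.\<close>

lemma bang_eq: "h \<in> Arr C \<Longrightarrow> Cod C h = one C \<Longrightarrow> h = bang C (Dom C h)"
  by (rule Prod_eqI[of "[]"]) (auto simp: one_def[symmetric])

lemma seq_bang [simp]:
  assumes "f \<in> Arr C" "X = Cod C f"
  shows "f ;; bang C X = bang C (Dom C f)"
  using assms bang_eq[of "f ;; bang C X"] by simp

lemma seq_bang_seq [simp]:
  assumes "f \<in> Arr C" "X = Cod C f" "g \<in> Arr C" "Dom C g = one C"
  shows "f ;; (bang C X ;; g) = bang C (Dom C f) ;; g"
  by (rule seq_cong_right) (use assms in simp_all)

lemma pow_proj_Arr [simp]:
  assumes "A \<in> Obj C" "i < k"
  shows "pow_proj C A k i \<in> Arr C" "Dom C (pow_proj C A k i) = pow C A k"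
    "Cod C (pow_proj C A k i) = A"
  using assms proj_Arr[of "replicate k A" i] by (auto simp: pow_proj_def pow_def)

lemma pow_eqI:
  assumes "A \<in> Obj C" "h \<in> Arr C" "h' \<in> Arr C" "Dom C h = Dom C h'"
    "Cod C h = pow C A k" "Cod C h' = pow C A k"
    "\<And>i. i < k \<Longrightarrow> h ;; pow_proj C A k i = h' ;; pow_proj C A k i"
  shows "h = h'"
  by (rule Prod_eqI[of "replicate k A"]) (use assms in \<open>auto simp: pow_proj_def pow_def\<close>)

text \<open>\<open>tuple\<close> aims at the product of the list of codomains; when these all equal
  \<open>A\<close>, that list is the \<open>replicate\<close> list on which \<open>pow\<close> is
  built.\<close>

lemma tuple_pow:
  assumes "X \<in> Obj C" "\<And>f. f \<in> set fs \<Longrightarrow> f \<in> Arr C \<and> Dom C f = X \<and> Cod C f = A" "length fs = k"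
  shows "tuple C X fs \<in> Arr C" "Dom C (tuple C X fs) = X" "Cod C (tuple C X fs) = pow C A k"
    and tuple_pow_proj: "\<And>i. i < k \<Longrightarrow> tuple C X fs ;; pow_proj C A k i = fs ! i"
proof -
  have "map (Cod C) fs = replicate k A"
    using assms by (auto intro!: replicate_eqI)
  then show "tuple C X fs \<in> Arr C" "Dom C (tuple C X fs) = X" "Cod C (tuple C X fs) = pow C A k"
    "\<And>i. i < k \<Longrightarrow> tuple C X fs ;; pow_proj C A k i = fs ! i"
    using assms tuple_Arr[of X fs] tuple_proj[of X fs] by (auto simp: pow_def pow_proj_def)
qed

lemma seq_tuple_pow:
  assumes "A \<in> Obj C" "h \<in> Arr C" "Cod C h = X"
    "\<And>f. f \<in> set fs \<Longrightarrow> f \<in> Arr C \<and> Dom C f = X \<and> Cod C f = A"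
  shows "h ;; tuple C X fs = tuple C (Dom C h) (map (\<lambda>f. h ;; f) fs)"
proof -
  let ?hs = "map (\<lambda>f. h ;; f) fs"
  have X: "X \<in> Obj C" and Y: "Dom C h \<in> Obj C" and len: "length ?hs = length fs"
    and hs: "\<And>f. f \<in> set ?hs \<Longrightarrow> f \<in> Arr C \<and> Dom C f = Dom C h \<and> Cod C f = A"
    using assms by auto
  note fs = tuple_pow[where fs = fs, OF X assms(4) refl] and hs' = tuple_pow[where fs = ?hs, OF Y hs len]
  show ?thesis
  proof (rule pow_eqI[of A _ _ "length fs"])
    fix i assume "i < length fs"
    then show "h ;; tuple C X fs ;; pow_proj C A (length fs) i
        = tuple C (Dom C h) ?hs ;; pow_proj C A (length fs) i"
      using assms fs tuple_pow_proj[where fs = fs, OF X assms(4) refl]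
        tuple_pow_proj[where fs = ?hs, OF Y hs len]
      by simp
  qed (use assms fs hs' in simp_all)
qed

section \<open>Binary products\<close>

lemma fst2_Arr [simp]:
  assumes "A \<in> Obj C" "B \<in> Obj C"
  shows "fst2 C A B \<in> Arr C" "Dom C (fst2 C A B) = prod2 C A B" "Cod C (fst2 C A B) = A"
  using assms proj_Arr[of "[A, B]" 0] by (auto simp: fst2_def prod2_def)

lemma snd2_Arr [simp]:
  assumes "A \<in> Obj C" "B \<in> Obj C"
  shows "snd2 C A B \<in> Arr C" "Dom C (snd2 C A B) = prod2 C A B" "Cod C (snd2 C A B) = B"
  using assms proj_Arr[of "[A, B]" 1] by (auto simp: snd2_def prod2_def)

lemma prod2_eqI:
  assumes "A \<in> Obj C" "B \<in> Obj C" "h \<in> Arr C" "h' \<in> Arr C" "Dom C h = Dom C h'"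
    "Cod C h = prod2 C A B" "Cod C h' = prod2 C A B"
    "h ;; fst2 C A B = h' ;; fst2 C A B" "h ;; snd2 C A B = h' ;; snd2 C A B"
  shows "h = h'"
  by (rule Prod_eqI[of "[A, B]"])
    (use assms in \<open>auto simp: fst2_def snd2_def prod2_def less_Suc_eq\<close>)

lemma pair_Arr [simp]:
  assumes "f \<in> Arr C" "g \<in> Arr C" "Dom C f = Dom C g"
  shows "pair C f g \<in> Arr C" "Dom C (pair C f g) = Dom C g"
    "Cod C (pair C f g) = prod2 C (Cod C f) (Cod C g)"
    and pair_fst2_Cod: "pair C f g ;; fst2 C (Cod C f) (Cod C g) = f"
    and pair_snd2_Cod: "pair C f g ;; snd2 C (Cod C f) (Cod C g) = g"
proof -
  have X: "Dom C f \<in> Obj C" and fs: "\<And>h. h \<in> set [f, g] \<Longrightarrow> h \<in> Arr C \<and> Dom C h = Dom C f"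
    using assms by auto
  show "pair C f g \<in> Arr C" "Dom C (pair C f g) = Dom C g"
    "Cod C (pair C f g) = prod2 C (Cod C f) (Cod C g)"
    using tuple_Arr[where fs = "[f, g]", OF X fs] assms by (auto simp: pair_def prod2_def)
  show "pair C f g ;; fst2 C (Cod C f) (Cod C g) = f"
    using tuple_proj[where fs = "[f, g]" and i = 0, OF X fs] by (simp add: pair_def fst2_def)
  show "pair C f g ;; snd2 C (Cod C f) (Cod C g) = g"
    using tuple_proj[where fs = "[f, g]" and i = 1, OF X fs] by (simp add: pair_def snd2_def)
qed

lemma pair_fst2 [simp]:
  assumes "f \<in> Arr C" "g \<in> Arr C" "Dom C f = Dom C g" "A = Cod C f" "B = Cod C g"
  shows "pair C f g ;; fst2 C A B = f"
  using assms pair_fst2_Cod by simp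

lemma pair_snd2 [simp]:
  assumes "f \<in> Arr C" "g \<in> Arr C" "Dom C f = Dom C g" "A = Cod C f" "B = Cod C g"
  shows "pair C f g ;; snd2 C A B = g"
  using assms pair_snd2_Cod by simp

lemma pair_fst2_seq [simp]:
  assumes "f \<in> Arr C" "g \<in> Arr C" "Dom C f = Dom C g" "A = Cod C f" "B = Cod C g"
    "h \<in> Arr C" "Dom C h = A"
  shows "pair C f g ;; (fst2 C A B ;; h) = f ;; h"
  by (rule seq_cong_right) (use assms in simp_all)

lemma pair_snd2_seq [simp]:
  assumes "f \<in> Arr C" "g \<in> Arr C" "Dom C f = Dom C g" "A = Cod C f" "B = Cod C g"
    "h \<in> Arr C" "Dom C h = B"
  shows "pair C f g ;; (snd2 C A B ;; h) = g ;; h"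
  by (rule seq_cong_right) (use assms in simp_all)

text \<open>Precomposition is pushed into pairs, and \<open>pair_cross\<close> and
  \<open>pair_assoc\<close> absorb the structural arrows that follow a pair. A model equation
  precomposed with a pair thus simplifies to one between nested pairs followed by the arrows of the
  model.\<close>

lemma seq_pair [simp]:
  assumes "f \<in> Arr C" "g \<in> Arr C" "Dom C f = Dom C g" "h \<in> Arr C" "Cod C h = Dom C f"
  shows "h ;; pair C f g = pair C (h ;; f) (h ;; g)"
  by (rule prod2_eqI[of "Cod C f" "Cod C g"]) (use assms in simp_all)

lemma seq_pair_seq [simp]:
  assumes "f \<in> Arr C" "g \<in> Arr C" "Dom C f = Dom C g" "h \<in> Arr C" "Cod C h = Dom C f"
    "k \<in> Arr C" "Dom C k = prod2 C (Cod C f) (Cod C g)"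
  shows "h ;; (pair C f g ;; k) = pair C (h ;; f) (h ;; g) ;; k"
  by (rule seq_cong_right) (use assms in simp_all)

lemma pair_eta [simp]:
  assumes "A \<in> Obj C" "B \<in> Obj C"
  shows "pair C (fst2 C A B) (snd2 C A B) = ident C (prod2 C A B)"
  by (rule prod2_eqI[of A B]) (use assms in simp_all)

lemma cross_Arr [simp]:
  assumes "f \<in> Arr C" "g \<in> Arr C"
  shows "cross C f g \<in> Arr C" "Dom C (cross C f g) = prod2 C (Dom C f) (Dom C g)"
    "Cod C (cross C f g) = prod2 C (Cod C f) (Cod C g)"
  unfolding cross_def using assms by simp_all

lemma pair_cross [simp]:
  assumes "f \<in> Arr C" "g \<in> Arr C" "Dom C f = Dom C g" "h \<in> Arr C" "k \<in> Arr C"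
    "Cod C f = Dom C h" "Cod C g = Dom C k"
  shows "pair C f g ;; cross C h k = pair C (f ;; h) (g ;; k)"
  unfolding cross_def using assms by simp

lemma pair_cross_seq [simp]:
  assumes "f \<in> Arr C" "g \<in> Arr C" "Dom C f = Dom C g" "h \<in> Arr C" "k \<in> Arr C"
    "Cod C f = Dom C h" "Cod C g = Dom C k" "m \<in> Arr C" "Dom C m = prod2 C (Cod C h) (Cod C k)"
  shows "pair C f g ;; (cross C h k ;; m) = pair C (f ;; h) (g ;; k) ;; m"
  by (rule seq_cong_right) (use assms in simp_all)

lemma cross_snd2 [simp]:
  assumes "f \<in> Arr C" "g \<in> Arr C" "A = Cod C f" "B = Cod C g"
  shows "cross C f g ;; snd2 C A B = snd2 C (Dom C f) (Dom C g) ;; g"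
  unfolding cross_def using assms by simp

lemma cross_fst2_seq [simp]:
  assumes "f \<in> Arr C" "g \<in> Arr C" "A = Cod C f" "B = Cod C g" "h \<in> Arr C" "Dom C h = A"
  shows "cross C f g ;; (fst2 C A B ;; h) = fst2 C (Dom C f) (Dom C g) ;; (f ;; h)"
  unfolding cross_def using assms by simp

lemma assoc_Arr [simp]:
  assumes "A \<in> Obj C" "B \<in> Obj C" "E \<in> Obj C"
  shows "assoc C A B E \<in> Arr C" "Dom C (assoc C A B E) = prod2 C (prod2 C A B) E"
    "Cod C (assoc C A B E) = prod2 C A (prod2 C B E)"
  unfolding assoc_def using assms by simp_all

lemma pair_assoc [simp]:
  assumes "f \<in> Arr C" "g \<in> Arr C" "h \<in> Arr C" "Dom C f = Dom C g" "Dom C g = Dom C h"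
    "A = Cod C f" "B = Cod C g" "E = Cod C h"
  shows "pair C (pair C f g) h ;; assoc C A B E = pair C f (pair C g h)"
  unfolding assoc_def using assms by simp

lemma pair_assoc_seq [simp]:
  assumes "f \<in> Arr C" "g \<in> Arr C" "h \<in> Arr C" "Dom C f = Dom C g" "Dom C g = Dom C h"
    "A = Cod C f" "B = Cod C g" "E = Cod C h"
    "k \<in> Arr C" "Dom C k = prod2 C A (prod2 C B E)"
  shows "pair C (pair C f g) h ;; (assoc C A B E ;; k) = pair C f (pair C g h) ;; k"
  by (rule seq_cong_right) (use assms in simp_all)

section \<open>Exponentials and currying\<close>

lemma ev_Arr [simp]:
  assumes "A \<in> Obj C" "B \<in> Obj C"
  shows "ev C A B \<in> Arr C" "Dom C (ev C A B) = prod2 C (Exp C A B) A" "Cod C (ev C A B) = B"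
  using ev_hom[OF assms] by (auto simp: hom_def)

lemma Curry_ex1:
  assumes "X \<in> Obj C" "A \<in> Obj C" "f \<in> Arr C" "Dom C f = prod2 C X A"
  shows "\<exists>!h. h \<in> hom C X (Exp C A (Cod C f)) \<and> cross C h (ident C A) ;; ev C A (Cod C f) = f"
  by (rule Exp_universal) (use assms in \<open>auto simp: hom_def\<close>)

lemma Curry_Arr [simp]:
  assumes "X \<in> Obj C" "A \<in> Obj C" "f \<in> Arr C" "Dom C f = prod2 C X A"
  shows "Curry C X A f \<in> Arr C" "Dom C (Curry C X A f) = X"
    "Cod C (Curry C X A f) = Exp C A (Cod C f)"
    and cross_Curry_ev: "cross C (Curry C X A f) (ident C A) ;; ev C A (Cod C f) = f"
  using theI'[OF Curry_ex1[OF assms]] unfolding Curry_def[symmetric] by (auto simp: hom_def)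

declare cross_Curry_ev [simp del]

lemma Curry_eqI:
  assumes "X \<in> Obj C" "A \<in> Obj C" "B \<in> Obj C" "h \<in> Arr C" "Dom C h = X" "Cod C h = Exp C A B"
    "cross C h (ident C A) ;; ev C A B = f"
  shows "Curry C X A f = h"
proof -
  have f: "f \<in> Arr C" "Dom C f = prod2 C X A" "Cod C f = B"
    using assms by auto
  show ?thesis
    unfolding Curry_def
    by (rule the1_equality[OF Curry_ex1[OF assms(1,2) f(1,2)]])
      (use assms f(3) in \<open>simp add: hom_def\<close>)
qed

text \<open>The defining equation of \<open>Curry\<close>, precomposed with the pair of
  \<open>a\<close> and \<open>b\<close>: evaluating a curried arrow at an arbitrary
  argument.\<close>

lemma pair_Curry_ev:
  assumes "X \<in> Obj C" "A \<in> Obj C" "f \<in> Arr C" "Dom C f = prod2 C X A"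
    "a \<in> Arr C" "b \<in> Arr C" "Dom C a = Dom C b" "Cod C a = X" "Cod C b = A" "B = Cod C f"
  shows "pair C (a ;; Curry C X A f) b ;; ev C A B = pair C a b ;; f"
proof -
  have "pair C a b ;; f = pair C a b ;; (cross C (Curry C X A f) (ident C A) ;; ev C A (Cod C f))"
    using assms by (simp only: cross_Curry_ev)
  then show ?thesis
    using assms by simp
qed

text \<open>Both sides uncurry to the same arrow: this is \<open>pair_Curry_ev\<close> with the
  arguments \<open>fst2\<close> followed by \<open>h\<close>, and \<open>snd2\<close>.\<close>

lemma seq_Curry:
  assumes "X \<in> Obj C" "A \<in> Obj C" "f \<in> Arr C" "Dom C f = prod2 C X A" "h \<in> Arr C" "Cod C h = X"
  shows "h ;; Curry C X A f = Curry C (Dom C h) A (cross C h (ident C A) ;; f)"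
proof (rule Curry_eqI[symmetric, where B = "Cod C f"])
  show "cross C (h ;; Curry C X A f) (ident C A) ;; ev C A (Cod C f) = cross C h (ident C A) ;; f"
    using assms pair_Curry_ev[of X A f "fst2 C (Dom C h) A ;; h" "snd2 C (Dom C h) A"]
    by (simp add: cross_def)
qed (use assms in simp_all)

lemma pow_snoc_Arr:
  assumes "A \<in> Obj C"
  shows "pow_snoc C A k \<in> Arr C" "Dom C (pow_snoc C A k) = prod2 C (pow C A k) A"
    "Cod C (pow_snoc C A k) = pow C A (Suc k)"
    and pow_snoc_proj: "\<And>i. i < k \<Longrightarrow> pow_snoc C A k ;; pow_proj C A (Suc k) i
      = fst2 C (pow C A k) A ;; pow_proj C A k i"
    and pow_snoc_proj_last: "pow_snoc C A k ;; pow_proj C A (Suc k) k = snd2 C (pow C A k) A"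
proof -
  let ?X = "prod2 C (pow C A k) A"
  let ?fs = "map (\<lambda>i. fst2 C (pow C A k) A ;; pow_proj C A k i) [0..<k] @ [snd2 C (pow C A k) A]"
  have X: "?X \<in> Obj C" and len: "length ?fs = Suc k"
    and fs: "\<And>f. f \<in> set ?fs \<Longrightarrow> f \<in> Arr C \<and> Dom C f = ?X \<and> Cod C f = A"
    using assms by auto
  show "pow_snoc C A k \<in> Arr C" "Dom C (pow_snoc C A k) = ?X"
    "Cod C (pow_snoc C A k) = pow C A (Suc k)"
    using tuple_pow[where fs = ?fs, OF X fs len] by (auto simp: pow_snoc_def)
  show "\<And>i. i < k \<Longrightarrow> pow_snoc C A k ;; pow_proj C A (Suc k) i
      = fst2 C (pow C A k) A ;; pow_proj C A k i"
    "pow_snoc C A k ;; pow_proj C A (Suc k) k = snd2 C (pow C A k) A"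
    using tuple_pow_proj[where fs = ?fs, OF X fs len] by (auto simp: pow_snoc_def nth_append)
qed

end

subsection \<open>Free variables and substitution\<close>

lemma FV_Case: "FV (Case \<theta> t) = FV_cb \<theta> \<union> FV t"
  by (auto simp: FV_cb_def fmlookup_ran'_iff)

lemma FV_cb_lookup: "fmlookup \<theta> c = Some u \<Longrightarrow> FV u \<subseteq> FV_cb \<theta>"
  using fmran'I[of \<theta> c u] by (auto simp: FV_cb_def)

lemma constrs_lookup: "fmlookup \<theta> c = Some u \<Longrightarrow> constrs u \<subseteq> constrs (Case \<theta> t)"
  using fmran'I[of \<theta> c u] by auto

lemma finite_FV [simp]: "finite (FV t)"
proof (induction t)
  case (Case \<theta> t)
  have "finite (fmran' \<theta>)"
    by (simp add: fmran'_alt_def)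
  with Case show ?case
    unfolding FV_Case FV_cb_def by auto
qed auto

text \<open>A finite set of naturals has a nonempty complement, so the \<open>LEAST\<close> in
  \<open>variant\<close> is attained.\<close>

lemma variant_fresh: "finite X \<Longrightarrow> variant y X \<notin> X"
  unfolding variant_def using LeastI_ex[OF ex_new_if_finite[OF infinite_UNIV_nat]] by auto

text \<open>A binder updates the substitution, so the induction has to cover every renaming of
  variables and not just a single replacement.\<close>

lemma constrs_msubst_rename: "constrs (msubst t (\<lambda>v. Var (r v))) = constrs t"
proof (induction t arbitrary: r)
  case (Lam y t)
  have upd: "(\<lambda>v. Var (r v))(y := Var z) = (\<lambda>v. Var ((r(y := z)) v))" for z
    by auto
  show ?case
    unfolding msubst.simps Let_def upd by (simp add: Lam.IH del: fun_upd_apply)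
next
  case (Case \<theta> t)
  then have "fmmap (constrs \<circ> (\<lambda>u. msubst u (\<lambda>v. Var (r v)))) \<theta> = fmmap constrs \<theta>"
    by (intro fmap.map_cong refl) auto
  with Case show ?case
    by (simp add: fmap.map_comp fmdom'_map)
qed auto

lemma constrs_subst_Var: "constrs (t[x ::= Var y]) = constrs t"
proof -
  have "Var(x := Var y) = (\<lambda>v. Var ((id(x := y)) v))"
    by auto
  then show ?thesis
    unfolding subst_def using constrs_msubst_rename by metis
qed

text \<open>Serves to bound the free variables of the renamed body that \<open>interp\<close> visits
  under an abstraction.\<close>

lemma FV_msubst: "FV (msubst t \<sigma>) \<subseteq> (\<Union>v \<in> FV t. FV (\<sigma> v))"
proof (induction t arbitrary: \<sigma>)
  case (Lam y t)
  show ?case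
    using Lam.IH by (fastforce simp: Let_def split: if_splits)
next
  case (Case \<theta> t)
  then show ?case
    by (fastforce simp: fmlookup_ran'_iff)
next
  case (App t u)
  then show ?case
    by fastforce
qed auto

lemma FV_subst_Var: "FV (t[x ::= Var y]) \<subseteq> insert y (FV t - {x})"
  using FV_msubst[of t "Var(x := Var y)"] unfolding subst_def by (auto split: if_splits)

subsection \<open>The model equations on generalised elements\<close>

context lambdaC_model
begin

declare D_Obj [simp]

lemma Dn_Obj [simp]: "Dn \<in> Obj M" and DD_Obj [simp]: "DD \<in> Obj M"
  by (simp_all add: Dn_def DD_def)

lemma Exp_D [simp]: "Exp M D D = DD"
  by (simp add: DD_def)

lemma pow_D [simp]: "pow M D n = Dn"
  by (simp add: Dn_def)

lemma structure_Arr [simp]: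
  "appM M \<in> Arr M" "Dom M (appM M) = D" "Cod M (appM M) = DD"
  "lamM M \<in> Arr M" "Dom M (lamM M) = DD" "Cod M (lamM M) = D"
  "failM M \<in> Arr M" "Dom M (failM M) = one M" "Cod M (failM M) = D"
  "caseM M \<in> Arr M" "Dom M (caseM M) = prod2 M Dn D" "Cod M (caseM M) = D"
  using app_hom lam_hom fail_hom case_hom by (auto simp: hom_def)

lemma con_Arr [simp]:
  assumes "i < n"
  shows "conM M i \<in> Arr M" "Dom M (conM M i) = one M" "Cod M (conM M i) = D"
  using con_hom[OF assms] by (auto simp: hom_def)

text \<open>\<open>dapp\<close>, \<open>dlam\<close> and \<open>dcase\<close> are application,
  abstraction and case on arrows out of an arbitrary stage. Keeping them folded separates the model
  equations from the later inductions on terms.\<close>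

definition dapp :: "'a \<Rightarrow> 'a \<Rightarrow> 'a" where
  "dapp f g = pair M f g ;; cross M (appM M) (ident M D) ;; ev M D D"

definition dlam :: "'o \<Rightarrow> 'a \<Rightarrow> 'a" where
  "dlam X f = Curry M X D f ;; lamM M"

definition dcase :: "'a \<Rightarrow> 'a \<Rightarrow> 'a" where
  "dcase f g = pair M f g ;; caseM M"

definition el :: "'o \<Rightarrow> 'a \<Rightarrow> bool" where
  "el X f \<longleftrightarrow> f \<in> Arr M \<and> Dom M f = X \<and> Cod M f = D"

lemma el_dapp [simp]: "el X f \<Longrightarrow> el X g \<Longrightarrow> el X (dapp f g)"
  by (simp add: dapp_def el_def)

lemma el_dlam [simp]: "X \<in> Obj M \<Longrightarrow> el (prod2 M X D) f \<Longrightarrow> el X (dlam X f)"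
  by (simp add: dlam_def el_def)

lemma el_dcase [simp]:
  "f \<in> Arr M \<Longrightarrow> Dom M f = X \<Longrightarrow> Cod M f = Dn \<Longrightarrow> el X g \<Longrightarrow> el X (dcase f g)"
  by (simp add: dcase_def el_def)

lemma seq_dapp:
  "el X f \<Longrightarrow> el X g \<Longrightarrow> h \<in> Arr M \<Longrightarrow> Cod M h = X \<Longrightarrow> h ;; dapp f g = dapp (h ;; f) (h ;; g)"
  by (simp add: dapp_def el_def)

text \<open>Under the binder the change of stage \<open>h\<close> acts on the first factor only and
  leaves the bound variable alone.\<close>

lemma seq_dlam:
  "X \<in> Obj M \<Longrightarrow> el (prod2 M X D) f \<Longrightarrow> h \<in> Arr M \<Longrightarrow> Cod M h = X \<Longrightarrow>
    h ;; dlam X f = dlam (Dom M h) (cross M h (ident M D) ;; f)"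
  using seq_Curry[of X D f h] seq_cong_right[of h "Curry M X D f" _ "lamM M"]
  by (simp add: dlam_def el_def)

lemma seq_dcase:
  "f \<in> Arr M \<Longrightarrow> Dom M f = X \<Longrightarrow> Cod M f = Dn \<Longrightarrow> el X g \<Longrightarrow> h \<in> Arr M \<Longrightarrow> Cod M h = X \<Longrightarrow>
    h ;; dcase f g = dcase (h ;; f) (h ;; g)"
  by (simp add: dcase_def el_def)

text \<open>\<open>lamM M ;; appM M\<close> cancels by (D1), leaving the evaluation of a curried
  arrow at \<open>u\<close>.\<close>

lemma dapp_dlam:
  assumes "X \<in> Obj M" "el (prod2 M X D) f" "el X u"
  shows "dapp (dlam X f) u = pair M (ident M X) u ;; f"
proof -
  have "pair M (ident M X ;; Curry M X D f) u ;; ev M D D = pair M (ident M X) u ;; f"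
    by (rule pair_Curry_ev) (use assms in \<open>simp_all add: el_def\<close>)
  with assms show ?thesis
    by (simp add: dapp_def dlam_def el_def D1(1))
qed

text \<open>By uniqueness of currying the curried arrow is \<open>f ;; appM M\<close>, and the other
  half of (D1) cancels \<open>appM M ;; lamM M\<close>. The prefix \<open>fst2\<close> weakens
  \<open>f\<close> to the stage with one more variable.\<close>

lemma dlam_dapp:
  assumes "X \<in> Obj M" "el X f"
  shows "dlam X (dapp (fst2 M X D ;; f) (snd2 M X D)) = f"
proof -
  have "Curry M X D (dapp (fst2 M X D ;; f) (snd2 M X D)) = f ;; appM M"
    by (rule Curry_eqI[where B = D]) (use assms in \<open>simp_all add: dapp_def el_def cross_def\<close>)
  then show ?thesis
    using assms D1(2) by (simp add: dlam_def el_def)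
qed

lemma dcase_con:
  assumes "f \<in> Arr M" "Dom M f = X" "Cod M f = Dn" "i < n"
  shows "dcase f (bang M X ;; conM M i) = f ;; pow_proj M D n i"
  unfolding D2[OF assms(4), symmetric] using assms by (auto simp: dcase_def)

text \<open>(D6) precomposed with the pair of \<open>f\<close> and \<open>bang M X\<close>.\<close>

lemma dcase_fail:
  assumes "f \<in> Arr M" "Dom M f = X" "Cod M f = Dn"
  shows "dcase f (bang M X ;; failM M) = bang M X ;; failM M"
proof -
  have "pair M f (bang M X) ;; (cross M (ident M Dn) (failM M) ;; caseM M)
      = pair M f (bang M X) ;; (snd2 M Dn (one M) ;; failM M)"
    by (simp only: D6)
  with assms show ?thesis
    by (auto simp: dcase_def)
qed

lemma dapp_dcase:
  assumes "f \<in> Arr M" "Dom M f = X" "Cod M f = Dn" "el X g" "el X h"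
  shows "dapp (dcase f g) h = dcase f (dapp g h)"
proof -
  have "pair M (pair M f g) h ;; (cross M (caseM M) (ident M D) ;;
          cross M (appM M) (ident M D) ;; ev M D D)
      = pair M (pair M f g) h ;; (assoc M Dn D D ;;
          cross M (ident M Dn) (cross M (appM M) (ident M D)) ;;
          cross M (ident M Dn) (ev M D D) ;; caseM M)"
    by (simp only: D3)
  with assms show ?thesis
    by (auto simp: dcase_def dapp_def el_def)
qed

text \<open>(D4) brings in \<open>caseHat M\<close>, which is itself a curried arrow. By
  \<open>seq_Curry\<close> the pair \<open>?k\<close> moves under that currying, where evaluating
  \<open>Curry M X D g\<close> at the new variable gives back \<open>g\<close>.\<close>

lemma dcase_dlam:
  assumes "X \<in> Obj M" "f \<in> Arr M" "Dom M f = X" "Cod M f = Dn" "el (prod2 M X D) g"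
  shows "dcase f (dlam X g) = dlam X (dcase (fst2 M X D ;; f) g)"
proof -
  let ?h = "assoc M Dn DD D ;; cross M (ident M Dn) (ev M D D) ;; caseM M"
  let ?k = "pair M f (Curry M X D g)"
  have hat: "caseHat M = Curry M (prod2 M Dn DD) D ?h"
    by (simp add: caseHat_def Let_def D_def[symmetric] n_def[symmetric])
  have "pair M (fst2 M X D ;; Curry M X D g) (snd2 M X D) ;; ev M D D
      = pair M (fst2 M X D) (snd2 M X D) ;; g"
    by (rule pair_Curry_ev) (use assms in \<open>simp_all add: el_def\<close>)
  then have g: "pair M (fst2 M X D ;; Curry M X D g) (snd2 M X D) ;; ev M D D = g"
    using assms by (simp add: el_def)
  have "dcase f (dlam X g) = ?k ;; (cross M (ident M Dn) (lamM M) ;; caseM M)"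
    using assms by (simp add: dcase_def dlam_def el_def)
  also have "\<dots> = ?k ;; (caseHat M ;; lamM M)"
    by (simp only: D4)
  also have "\<dots> = (?k ;; caseHat M) ;; lamM M"
    using assms by (simp add: hat el_def del: seq_pair_seq)
  also have "?k ;; caseHat M = Curry M X D (cross M ?k (ident M D) ;; ?h)"
    using assms seq_Curry[of "prod2 M Dn DD" D ?h ?k] by (simp add: hat el_def)
  also have "cross M ?k (ident M D) ;; ?h = dcase (fst2 M X D ;; f) g"
    using assms g by (simp add: dcase_def el_def cross_def)
  finally show ?thesis
    by (simp add: dlam_def)
qed

lemma compM_Arr:
  shows "compM M \<in> Arr M" "Dom M (compM M) = prod2 M Dn Dn" "Cod M (compM M) = Dn"
    and compM_proj: "\<And>i. i < n \<Longrightarrow>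
      compM M ;; pow_proj M D n i = cross M (ident M Dn) (pow_proj M D n i) ;; caseM M"
proof -
  let ?fs = "map (\<lambda>i. cross M (ident M Dn) (pow_proj M D n i) ;; caseM M) [0..<n]"
  have X: "prod2 M Dn Dn \<in> Obj M" and len: "length ?fs = n"
    and fs: "\<And>f. f \<in> set ?fs \<Longrightarrow> f \<in> Arr M \<and> Dom M f = prod2 M Dn Dn \<and> Cod M f = D"
    by auto
  have "compM M = tuple M (prod2 M Dn Dn) ?fs"
    by (simp add: compM_def Let_def D_def[symmetric] n_def[symmetric])
  then show "compM M \<in> Arr M" "Dom M (compM M) = prod2 M Dn Dn" "Cod M (compM M) = Dn"
    "\<And>i. i < n \<Longrightarrow>
      compM M ;; pow_proj M D n i = cross M (ident M Dn) (pow_proj M D n i) ;; caseM M"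
    using tuple_pow[where fs = ?fs, OF X fs len] tuple_pow_proj[where fs = ?fs, OF X fs len] by auto
qed

text \<open>(D5) precomposed with the nested pair of \<open>f\<close>, \<open>g\<close> and
  \<open>h\<close>.\<close>

lemma dcase_dcase:
  assumes "f \<in> Arr M" "Dom M f = X" "Cod M f = Dn" "g \<in> Arr M" "Dom M g = X" "Cod M g = Dn"
    "el X h"
  shows "dcase f (dcase g h) = dcase (pair M f g ;; compM M) h"
proof -
  have "pair M (pair M f g) h ;; (cross M (compM M) (ident M D) ;; caseM M)
      = pair M (pair M f g) h ;; (assoc M Dn Dn D ;; cross M (ident M Dn) (caseM M) ;; caseM M)"
    by (simp only: D5)
  with assms show ?thesis
    by (auto simp: dcase_def el_def compM_Arr)
qed

subsection \<open>Reading terms under valuations\<close>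

text \<open>Terms are read at a stage \<open>X\<close> under a total valuation of the variables, because a conversion
  between terms over \<open>\<Gamma>\<close> may pass through terms with other free variables. Reading the junk constructors
  \<open>Con c\<close> with \<open>c \<ge> n\<close> as failure makes every term well-typed.\<close>

primrec sem :: "trm \<Rightarrow> 'o \<Rightarrow> (var \<Rightarrow> 'a) \<Rightarrow> 'a" where
  "sem (Var x) X \<rho> = \<rho> x"
| "sem (App t u) X \<rho> = dapp (sem t X \<rho>) (sem u X \<rho>)"
| "sem (Lam x t) X \<rho> =
     dlam X (sem t (prod2 M X D) ((\<lambda>v. fst2 M X D ;; \<rho> v)(x := snd2 M X D)))"
| "sem (Con c) X \<rho> = bang M X ;; (if c < n then conM M c else failM M)"
| "sem (Case \<theta> t) X \<rho> =
     dcase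
       (tuple M X
         (map (\<lambda>i. case fmlookup (fmmap sem \<theta>) i of
                     Some s \<Rightarrow> s X \<rho>
                   | None \<Rightarrow> bang M X ;; failM M) [0..<n]))
       (sem t X \<rho>)"

definition branch :: "case_binding \<Rightarrow> 'o \<Rightarrow> (var \<Rightarrow> 'a) \<Rightarrow> nat \<Rightarrow> 'a" where
  "branch \<theta> X \<rho> i = (case fmlookup \<theta> i of Some u \<Rightarrow> sem u X \<rho> | None \<Rightarrow> bang M X ;; failM M)"

definition sem_cb :: "case_binding \<Rightarrow> 'o \<Rightarrow> (var \<Rightarrow> 'a) \<Rightarrow> 'a" where
  "sem_cb \<theta> X \<rho> = tuple M X (map (branch \<theta> X \<rho>) [0..<n])"

text \<open>Primitive recursion through the finite map reaches the branches as
  \<open>fmmap sem \<theta>\<close>; the clause is restated with lookups in \<open>\<theta>\<close>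
  itself and replaces the generated equation as the working form.\<close>

lemma sem_Case: "sem (Case \<theta> t) X \<rho> = dcase (sem_cb \<theta> X \<rho>) (sem t X \<rho>)"
proof -
  have "(\<lambda>i. case fmlookup (fmmap sem \<theta>) i of Some s \<Rightarrow> s X \<rho> | None \<Rightarrow> bang M X ;; failM M)
      = branch \<theta> X \<rho>"
    by (auto simp: branch_def fun_eq_iff split: option.splits)
  then show ?thesis
    by (simp add: sem_cb_def)
qed

declare sem.simps(5) [simp del]

definition env :: "'o \<Rightarrow> (var \<Rightarrow> 'a) \<Rightarrow> bool" where
  "env X \<rho> \<longleftrightarrow> X \<in> Obj M \<and> (\<forall>v. el X (\<rho> v))"

lemma env_lift:
  "env X \<rho> \<Longrightarrow> env (prod2 M X D) ((\<lambda>v. fst2 M X D ;; \<rho> v)(x := snd2 M X D))"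
  by (simp add: env_def el_def)

lemma env_seq: "env X \<rho> \<Longrightarrow> h \<in> Arr M \<Longrightarrow> Cod M h = X \<Longrightarrow> env (Dom M h) (\<lambda>v. h ;; \<rho> v)"
  by (simp add: env_def el_def)

lemma env_Obj: "env X \<rho> \<Longrightarrow> X \<in> Obj M"
  by (simp add: env_def)

lemma el_fail: "X \<in> Obj M \<Longrightarrow> el X (bang M X ;; failM M)"
  by (simp add: el_def)

lemma tuple_el:
  assumes "X \<in> Obj M" "\<And>i. i < n \<Longrightarrow> el X (f i)"
  shows "tuple M X (map f [0..<n]) \<in> Arr M" "Dom M (tuple M X (map f [0..<n])) = X"
    "Cod M (tuple M X (map f [0..<n])) = Dn"
    and tuple_el_proj: "\<And>i. i < n \<Longrightarrow> tuple M X (map f [0..<n]) ;; pow_proj M D n i = f i"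
    and seq_tuple_el: "\<And>h. h \<in> Arr M \<Longrightarrow> Cod M h = X \<Longrightarrow>
      h ;; tuple M X (map f [0..<n]) = tuple M (Dom M h) (map (\<lambda>i. h ;; f i) [0..<n])"
proof -
  let ?fs = "map f [0..<n]"
  have len: "length ?fs = n"
    and fs: "\<And>g. g \<in> set ?fs \<Longrightarrow> g \<in> Arr M \<and> Dom M g = X \<and> Cod M g = D"
    using assms by (auto simp: el_def)
  show "tuple M X ?fs \<in> Arr M" "Dom M (tuple M X ?fs) = X" "Cod M (tuple M X ?fs) = Dn"
    "\<And>i. i < n \<Longrightarrow> tuple M X ?fs ;; pow_proj M D n i = f i"
    using tuple_pow[where fs = ?fs, OF assms(1) fs len]
      tuple_pow_proj[where fs = ?fs, OF assms(1) fs len] by auto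
  show "h ;; tuple M X ?fs = tuple M (Dom M h) (map (\<lambda>i. h ;; f i) [0..<n])"
    if "h \<in> Arr M" "Cod M h = X" for h
    using seq_tuple_pow[where fs = ?fs, OF D_Obj that fs] by (simp add: comp_def)
qed

lemma el_sem: "env X \<rho> \<Longrightarrow> el X (sem t X \<rho>)"
proof (induction t arbitrary: X \<rho>)
  case (Var x)
  then show ?case
    by (simp add: env_def)
next
  case (Lam x t)
  then show ?case
    using el_dlam[OF env_Obj Lam.IH[OF env_lift]] by (simp del: fun_upd_apply)
next
  case (Con c)
  then show ?case
    by (simp add: env_Obj el_def)
next
  case (Case \<theta> t)
  have "el X (branch \<theta> X \<rho> i)" for i
    using Case el_fail[OF env_Obj] by (auto simp: branch_def fmran'I split: option.splits)
  with Case show ?case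
    unfolding sem_Case sem_cb_def by (intro el_dcase tuple_el) (auto simp: env_Obj)
qed auto

lemma sem_Arr:
  assumes "env X \<rho>"
  shows "sem t X \<rho> \<in> Arr M" "Dom M (sem t X \<rho>) = X" "Cod M (sem t X \<rho>) = D"
  using el_sem[OF assms] by (auto simp: el_def)

lemma el_branch: "env X \<rho> \<Longrightarrow> el X (branch \<theta> X \<rho> i)"
  using el_sem el_fail[OF env_Obj] by (auto simp: branch_def split: option.splits)

lemma sem_cb_Arr:
  assumes "env X \<rho>"
  shows "sem_cb \<theta> X \<rho> \<in> Arr M" "Dom M (sem_cb \<theta> X \<rho>) = X" "Cod M (sem_cb \<theta> X \<rho>) = Dn"
    and sem_cb_proj: "\<And>i. i < n \<Longrightarrow> sem_cb \<theta> X \<rho> ;; pow_proj M D n i = branch \<theta> X \<rho> i"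
  unfolding sem_cb_def
  using tuple_el[OF env_Obj[OF assms] el_branch[OF assms]]
    tuple_el_proj[OF env_Obj[OF assms] el_branch[OF assms]] by auto

lemma sem_cb_eqI:
  "(\<And>i. i < n \<Longrightarrow> branch \<theta> X \<rho> i = branch \<phi> X \<rho>' i) \<Longrightarrow> sem_cb \<theta> X \<rho> = sem_cb \<phi> X \<rho>'"
  unfolding sem_cb_def by (intro arg_cong[where f = "tuple M X"] map_cong) auto

text \<open>Later this turns the side conditions on free variables, such as
  \<open>x \<notin> FV t\<close>, into the freedom to change a valuation at
  \<open>x\<close>.\<close>

lemma sem_cong: "(\<And>v. v \<in> FV t \<Longrightarrow> \<rho> v = \<rho>' v) \<Longrightarrow> sem t X \<rho> = sem t X \<rho>'"
proof (induction t arbitrary: X \<rho> \<rho>')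
  case (Lam x t)
  have "sem t (prod2 M X D) ((\<lambda>v. fst2 M X D ;; \<rho> v)(x := snd2 M X D))
      = sem t (prod2 M X D) ((\<lambda>v. fst2 M X D ;; \<rho>' v)(x := snd2 M X D))"
    by (rule Lam.IH) (use Lam.prems in auto)
  then show ?case
    by simp
next
  case (Case \<theta> t)
  have "sem u X \<rho> = sem u X \<rho>'" if "fmlookup \<theta> i = Some u" for i u
    by (rule Case.IH(1)[OF fmran'I[OF that]])
      (use Case.prems FV_cb_lookup[OF that] FV_Case in blast)
  then have "sem_cb \<theta> X \<rho> = sem_cb \<theta> X \<rho>'"
    by (intro sem_cb_eqI) (auto simp: branch_def split: option.splits)
  moreover have "sem t X \<rho> = sem t X \<rho>'"
    by (rule Case.IH(2)) (use Case.prems in \<open>simp add: FV_Case\<close>)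
  ultimately show ?case
    by (simp add: sem_Case)
next
  case (App t u)
  have "sem t X \<rho> = sem t X \<rho>'" "sem u X \<rho> = sem u X \<rho>'"
    by (rule App.IH; use App.prems in simp)+
  then show ?case
    by simp
qed auto

lemma sem_cb_cong:
  assumes "\<And>v. v \<in> FV_cb \<theta> \<Longrightarrow> \<rho> v = \<rho>' v"
  shows "sem_cb \<theta> X \<rho> = sem_cb \<theta> X \<rho>'"
proof (rule sem_cb_eqI)
  have "sem u X \<rho> = sem u X \<rho>'" if "fmlookup \<theta> i = Some u" for i u
    using assms FV_cb_lookup[OF that] by (intro sem_cong) blast
  then show "branch \<theta> X \<rho> i = branch \<theta> X \<rho>' i" for i
    by (auto simp: branch_def split: option.splits)
qed

lemma seq_sem:
  "env X \<rho> \<Longrightarrow> h \<in> Arr M \<Longrightarrow> Cod M h = X \<Longrightarrow> h ;; sem t X \<rho> = sem t (Dom M h) (\<lambda>v. h ;; \<rho> v)"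
proof (induction t arbitrary: X \<rho> h)
  case (App t u)
  then show ?case
    using seq_dapp[OF el_sem el_sem] by simp
next
  case (Lam x t)
  let ?h = "cross M h (ident M D)" and ?\<rho> = "(\<lambda>v. fst2 M X D ;; \<rho> v)(x := snd2 M X D)"
  have el: "\<And>v. \<rho> v \<in> Arr M \<and> Dom M (\<rho> v) = X" and X: "X \<in> Obj M"
    using Lam.prems by (auto simp: env_def el_def)
  have "h ;; sem (Lam x t) X \<rho> = dlam (Dom M h) (?h ;; sem t (prod2 M X D) ?\<rho>)"
    using Lam.prems seq_dlam[OF X el_sem[OF env_lift]] by simp
  also have "?h ;; sem t (prod2 M X D) ?\<rho> = sem t (prod2 M (Dom M h) D) (\<lambda>v. ?h ;; ?\<rho> v)"
    using Lam.IH[OF env_lift[OF Lam.prems(1)], of ?h x] Lam.prems by (simp del: fun_upd_apply)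
  \<comment> \<open>Lifting a valuation under a binder commutes with the change of stage, both at
    \<open>x\<close> and away from it.\<close>
  also have "(\<lambda>v. ?h ;; ?\<rho> v)
      = (\<lambda>v. fst2 M (Dom M h) D ;; (h ;; \<rho> v))(x := snd2 M (Dom M h) D)"
    using Lam.prems el X by (auto simp: fun_eq_iff)
  finally show ?case
    by (simp del: fun_upd_apply)
next
  case (Con c)
  then show ?case
    by simp
next
  case (Case \<theta> t)
  have "h ;; branch \<theta> X \<rho> i = branch \<theta> (Dom M h) (\<lambda>v. h ;; \<rho> v) i" for i
    using Case by (auto simp: branch_def fmran'I split: option.splits)
  then have "h ;; sem_cb \<theta> X \<rho> = sem_cb \<theta> (Dom M h) (\<lambda>v. h ;; \<rho> v)"
    using Case.prems seq_tuple_el[OF env_Obj el_branch] by (simp add: sem_cb_def)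
  with Case show ?case
    using seq_dcase[OF sem_cb_Arr(1-3) el_sem] by (simp add: sem_Case)
qed auto

lemma seq_sem_cb:
  assumes "env X \<rho>" "h \<in> Arr M" "Cod M h = X"
  shows "h ;; sem_cb \<theta> X \<rho> = sem_cb \<theta> (Dom M h) (\<lambda>v. h ;; \<rho> v)"
proof -
  have "h ;; branch \<theta> X \<rho> i = branch \<theta> (Dom M h) (\<lambda>v. h ;; \<rho> v) i" for i
    using assms seq_sem by (auto simp: branch_def split: option.splits)
  then show ?thesis
    using assms seq_tuple_el[OF env_Obj el_branch] by (simp add: sem_cb_def)
qed

text \<open>Simultaneous substitution is the right generality: under a binder the induction
  hypothesis is applied to the updated substitution \<open>\<sigma>(y := Var z)\<close>.\<close>

lemma sem_msubst:
  "env X \<rho> \<Longrightarrow> sem (msubst t \<sigma>) X \<rho> = sem t X (\<lambda>v. sem (\<sigma> v) X \<rho>)"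
proof (induction t arbitrary: X \<rho> \<sigma>)
  case (Lam y t)
  define z where "z = variant y (\<Union>v \<in> FV t - {y}. FV (\<sigma> v))"
  let ?X = "prod2 M X D"
  let ?\<rho> = "(\<lambda>v. fst2 M X D ;; \<rho> v)(z := snd2 M X D)"
  \<comment> \<open>This is where capture avoidance enters: the new bound variable is not free in
    any term substituted into the body.\<close>
  have z: "z \<notin> FV (\<sigma> v)" if "v \<in> FV t" "v \<noteq> y" for v
    using that variant_fresh[of "\<Union>v \<in> FV t - {y}. FV (\<sigma> v)" y] by (auto simp: z_def)
  have X: "X \<in> Obj M"
    using Lam.prems by (rule env_Obj)
  have "sem (msubst t (\<sigma>(y := Var z))) ?X ?\<rho> = sem t ?X (\<lambda>v. sem ((\<sigma>(y := Var z)) v) ?X ?\<rho>)"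
    by (rule Lam.IH[OF env_lift[OF Lam.prems]])
  also have "\<dots> = sem t ?X ((\<lambda>v. fst2 M X D ;; sem (\<sigma> v) X \<rho>)(y := snd2 M X D))"
  proof (rule sem_cong)
    fix v assume v: "v \<in> FV t"
    show "sem ((\<sigma>(y := Var z)) v) ?X ?\<rho> = ((\<lambda>v. fst2 M X D ;; sem (\<sigma> v) X \<rho>)(y := snd2 M X D)) v"
    proof (cases "v = y")
      case False
      \<comment> \<open>Since \<open>z\<close> is not free in \<open>\<sigma> v\<close>, its value
        may be reset; what remains is a weakening along \<open>fst2\<close>, which naturality pulls
        out.\<close>
      have "sem (\<sigma> v) ?X ?\<rho> = sem (\<sigma> v) ?X (\<lambda>v. fst2 M X D ;; \<rho> v)"
        by (rule sem_cong) (use z[OF v False] in auto)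
      also have "\<dots> = fst2 M X D ;; sem (\<sigma> v) X \<rho>"
        using seq_sem[OF Lam.prems, of "fst2 M X D"] X by simp
      finally show ?thesis
        using False by simp
    qed simp
  qed
  finally show ?case
    by (simp add: Let_def z_def)
next
  case (Case \<theta> t)
  have "sem_cb (fmmap (\<lambda>u. msubst u \<sigma>) \<theta>) X \<rho> = sem_cb \<theta> X (\<lambda>v. sem (\<sigma> v) X \<rho>)"
    by (rule sem_cb_eqI) (use Case in \<open>auto simp: branch_def fmran'I split: option.splits\<close>)
  with Case show ?case
    by (simp add: sem_Case)
qed auto

lemma sem_subst: "env X \<rho> \<Longrightarrow> sem (t[x ::= u]) X \<rho> = sem t X (\<rho>(x := sem u X \<rho>))"
  unfolding subst_def by (auto simp: sem_msubst intro!: sem_cong)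

subsection \<open>Soundness\<close>

lemma sem_lc_rule:
  assumes "lc_rule t t'" "t \<in> lc_terms n" "env X \<rho>"
  shows "sem t X \<rho> = sem t' X \<rho>"
  using assms
proof cases
  case (AppLam x t u)
  let ?p = "pair M (ident M X) (sem u X \<rho>)"
  let ?\<rho> = "(\<lambda>v. fst2 M X D ;; \<rho> v)(x := snd2 M X D)"
  note X = env_Obj[OF assms(3)]
  have p: "?p \<in> Arr M" "Dom M ?p = X" "Cod M ?p = prod2 M X D"
    using X assms(3) by (auto simp: sem_Arr)
  have "dapp (sem (Lam x t) X \<rho>) (sem u X \<rho>) = ?p ;; sem t (prod2 M X D) ?\<rho>"
    using assms(3) X by (simp add: dapp_dlam el_sem env_lift)
  also have "\<dots> = sem t X (\<lambda>v. ?p ;; ?\<rho> v)"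
    using seq_sem[OF env_lift[OF assms(3)] p(1,3)] p(2) by simp
  \<comment> \<open>Precomposing with \<open>?p\<close> cancels the lifting and puts the argument in
    place of the bound variable.\<close>
  also have "(\<lambda>v. ?p ;; ?\<rho> v) = \<rho>(x := sem u X \<rho>)"
    using assms(3) X by (auto simp: fun_eq_iff sem_Arr env_def el_def)
  finally show ?thesis
    using AppLam assms(3) by (simp add: sem_subst fun_upd_def)
next
  case (LamApp x)
  note X = env_Obj[OF assms(3)]
  have "sem t' (prod2 M X D) ((\<lambda>v. fst2 M X D ;; \<rho> v)(x := snd2 M X D))
      = sem t' (prod2 M X D) (\<lambda>v. fst2 M X D ;; \<rho> v)"
    by (rule sem_cong) (use LamApp in auto)
  also have "\<dots> = fst2 M X D ;; sem t' X \<rho>"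
    using seq_sem[OF assms(3), of "fst2 M X D"] X by simp
  finally show ?thesis
    using LamApp X assms(3) by (simp add: dlam_dapp el_sem)
next
  case (CaseCons \<theta> c)
  \<comment> \<open>The bound makes \<open>sem\<close> read \<open>Con c\<close> as
    \<open>conM M c\<close> and not as failure, so that (D2) applies.\<close>
  then have "c < n"
    using assms(2) by (auto simp: lc_terms_def)
  with CaseCons assms(3) show ?thesis
    using dcase_con[OF sem_cb_Arr(1-3)] by (simp add: sem_Case sem_cb_proj branch_def)
next
  case (CaseApp \<theta> t u)
  with assms(3) show ?thesis
    using dapp_dcase[OF sem_cb_Arr(1-3) el_sem el_sem] by (simp add: sem_Case)
next
  case (CaseLam x \<theta> t)
  note X = env_Obj[OF assms(3)]
  have "sem_cb \<theta> (prod2 M X D) ((\<lambda>v. fst2 M X D ;; \<rho> v)(x := snd2 M X D))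
      = sem_cb \<theta> (prod2 M X D) (\<lambda>v. fst2 M X D ;; \<rho> v)"
    by (rule sem_cb_cong) (use CaseLam in auto)
  also have "\<dots> = fst2 M X D ;; sem_cb \<theta> X \<rho>"
    using seq_sem_cb[OF assms(3), of "fst2 M X D"] X by simp
  finally show ?thesis
    using CaseLam dcase_dlam[OF X sem_cb_Arr(1-3) el_sem[OF env_lift]] assms(3)
    by (simp add: sem_Case)
next
  case (CaseCase \<theta> \<phi> t)
  note X = env_Obj[OF assms(3)]
  \<comment> \<open>For \<open>i\<close> outside the domain of \<open>\<phi>\<close> the left side
    is failure, and (D6) makes the right side failure as well.\<close>
  have br: "branch (\<theta> \<circ>\<^sub>c \<phi>) X \<rho> i = dcase (sem_cb \<theta> X \<rho>) (branch \<phi> X \<rho> i)" for i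
    using dcase_fail[OF sem_cb_Arr(1-3)] assms(3)
    by (auto simp: branch_def cb_comp_def sem_Case split: option.splits)
  \<comment> \<open>Compared componentwise: each component of \<open>compM M\<close> applies
    \<open>caseM M\<close> to one branch of \<open>\<phi>\<close>, as described by
    \<open>br\<close>.\<close>
  have "pair M (sem_cb \<theta> X \<rho>) (sem_cb \<phi> X \<rho>) ;; compM M = sem_cb (\<theta> \<circ>\<^sub>c \<phi>) X \<rho>"
  proof (rule pow_eqI[of D _ _ n])
    fix i assume "i < n"
    then show "pair M (sem_cb \<theta> X \<rho>) (sem_cb \<phi> X \<rho>) ;; compM M ;; pow_proj M D n i
        = sem_cb (\<theta> \<circ>\<^sub>c \<phi>) X \<rho> ;; pow_proj M D n i"
      using assms(3) by (simp add: sem_cb_Arr sem_cb_proj compM_Arr compM_proj br dcase_def)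
  qed (use assms(3) in \<open>simp_all add: sem_cb_Arr compM_Arr\<close>)
  with CaseCase show ?thesis
    using dcase_dcase[OF sem_cb_Arr(1-3) sem_cb_Arr(1-3) el_sem] assms(3) by (simp add: sem_Case)
qed

lemma sem_alpha_rule:
  assumes "alpha_rule t t'" "env X \<rho>"
  shows "sem t X \<rho> = sem t' X \<rho>"
  using assms(1)
proof cases
  case (1 y t x)
  \<comment> \<open>After the substitution lemma both valuations send \<open>x\<close> to
    \<open>snd2\<close>; they can differ only at \<open>y\<close>, which is not free in
    \<open>t\<close>.\<close>
  have "sem (t[x ::= Var y]) (prod2 M X D) ((\<lambda>v. fst2 M X D ;; \<rho> v)(y := snd2 M X D))
      = sem t (prod2 M X D) ((\<lambda>v. fst2 M X D ;; \<rho> v)(x := snd2 M X D))"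
    using sem_subst[OF env_lift[OF assms(2)]] 1 by (auto intro!: sem_cong)
  with 1 show ?thesis
    by simp
qed

text \<open>Stage and valuation are arbitrary in the assumption on \<open>R\<close>, because a step
  below a binder takes place at the stage extended by \<open>D\<close>. Membership in
  \<open>lc_terms n\<close> passes down to subterms.\<close>

lemma sem_ctxt_closure:
  assumes root: "\<And>t t' X \<rho>. R t t' \<Longrightarrow> t \<in> lc_terms n \<Longrightarrow> env X \<rho> \<Longrightarrow> sem t X \<rho> = sem t' X \<rho>"
    and "ctxt_closure R t t'" "t \<in> lc_terms n" "env X \<rho>"
  shows "sem t X \<rho> = sem t' X \<rho>"
  using assms(2-)
proof (induction arbitrary: X \<rho> rule: ctxt_closure.induct)
  case (root t t')
  then show ?case
    using assms(1) by blast
next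
  case (lam t t' x)
  then show ?case
    using env_lift by (simp add: lc_terms_def)
next
  case (case_arg t t' \<theta>)
  then show ?case
    by (simp add: lc_terms_def sem_Case)
next
  case (case_binding \<theta> c u u' t)
  then have "u \<in> lc_terms n"
    using constrs_lookup[OF case_binding.hyps(1), of t] by (simp only: lc_terms_def mem_Collect_eq)
  \<comment> \<open>The two case-bindings differ only in the branch at \<open>c\<close>, where the
    induction hypothesis applies.\<close>
  then have "sem_cb \<theta> X \<rho> = sem_cb (fmupd c u' \<theta>) X \<rho>"
    using case_binding by (intro sem_cb_eqI) (auto simp: branch_def)
  then show ?case
    by (simp add: sem_Case)
qed (auto simp: lc_terms_def)

lemma sem_lc_conv:
  assumes "lc_conv n t t'" "env X \<rho>"
  shows "sem t X \<rho> = sem t' X \<rho>"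
proof -
  have step: "sem u X \<rho> = sem u' X \<rho>"
    if "u \<in> lc_terms n \<and> u' \<in> lc_terms n \<and> (lc_red u u' \<or> alpha_step u u')" for u u'
    using that assms(2) sem_ctxt_closure[of lc_rule u u'] sem_ctxt_closure[of alpha_rule u u']
      sem_lc_rule sem_alpha_rule unfolding lc_red_def alpha_step_def by metis
  show ?thesis
    using assms(1) unfolding lc_conv_def
    by (induction rule: equivclp_induct) (use step in metis)+
qed

section \<open>Contexts as valuations\<close>

definition ctxt_env :: "var list \<Rightarrow> var \<Rightarrow> 'a" where
  "ctxt_env \<Gamma> v =
    (if v \<in> set \<Gamma> then pow_proj M D (length \<Gamma>) (THE i. i < length \<Gamma> \<and> \<Gamma> ! i = v)
     else bang M (pow M D (length \<Gamma>)) ;; failM M)"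

lemma the_index:
  assumes "distinct \<Gamma>" "i < length \<Gamma>"
  shows "(THE j. j < length \<Gamma> \<and> \<Gamma> ! j = \<Gamma> ! i) = i"
  using assms by (auto simp: nth_eq_iff_index_eq)

lemma ctxt_env_nth:
  "distinct \<Gamma> \<Longrightarrow> i < length \<Gamma> \<Longrightarrow> ctxt_env \<Gamma> (\<Gamma> ! i) = pow_proj M D (length \<Gamma>) i"
  by (simp add: ctxt_env_def the_index)

lemma env_ctxt_env:
  assumes "distinct \<Gamma>"
  shows "env (pow M D (length \<Gamma>)) (ctxt_env \<Gamma>)"
proof -
  have "el (pow M D (length \<Gamma>)) (ctxt_env \<Gamma> v)" for v
  proof (cases "v \<in> set \<Gamma>")
    case True
    then obtain i where "i < length \<Gamma>" "v = \<Gamma> ! i"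
      by (auto simp: in_set_conv_nth)
    with assms show ?thesis
      by (simp add: ctxt_env_nth el_def)
  qed (simp add: ctxt_env_def el_def)
  then show ?thesis
    by (simp add: env_def)
qed

text \<open>The induction is on size, not structure: for \<open>Lam x u\<close> the function
  \<open>interp\<close> recurs on the renamed body \<open>u[x ::= Var y]\<close>, which need not be
  a subterm.\<close>

lemma interp_eq_sem:
  "distinct \<Gamma> \<Longrightarrow> FV t \<subseteq> set \<Gamma> \<Longrightarrow> t \<in> lc_terms n \<Longrightarrow>
    interp M t \<Gamma> = sem t (pow M D (length \<Gamma>)) (ctxt_env \<Gamma>)"
proof (induction t arbitrary: \<Gamma> rule: measure_induct_rule[where f = size])
  case (less t)
  let ?k = "length \<Gamma>"
  let ?X = "pow M D ?k"
  note env = env_ctxt_env[OF less.prems(1)]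
  show ?case
  proof (cases t)
    case (Var x)
    with less.prems show ?thesis
      by (simp add: ctxt_env_def D_def)
  next
    case (App u v)
    with less show ?thesis
      by (simp add: dapp_def D_def lc_terms_def)
  next
    case (Lam x u)
    define y where "y = variant x (set \<Gamma> \<union> (FV u - {x}))"
    let ?\<rho> = "(\<lambda>v. fst2 M ?X D ;; ctxt_env \<Gamma> v)(x := snd2 M ?X D)"
    have y: "y \<notin> set \<Gamma>"
      using variant_fresh[of "set \<Gamma> \<union> (FV u - {x})" x] by (auto simp: y_def)
    then have dist: "distinct (\<Gamma> @ [y])"
      using less.prems by simp
    note env' = env_ctxt_env[OF dist]
    note snoc = pow_snoc_Arr[of D ?k]
    have "interp M (u[x ::= Var y]) (\<Gamma> @ [y])
        = sem (u[x ::= Var y]) (pow M D (length (\<Gamma> @ [y]))) (ctxt_env (\<Gamma> @ [y]))"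
    proof (rule less.IH[OF _ dist])
      show "size (u[x ::= Var y]) < size t"
        by (simp add: Lam size_subst_Var)
      show "FV (u[x ::= Var y]) \<subseteq> set (\<Gamma> @ [y])"
        using FV_subst_Var[of u x y] less.prems Lam by auto
      show "u[x ::= Var y] \<in> lc_terms n"
        using less.prems Lam by (simp add: lc_terms_def constrs_subst_Var)
    qed
    \<comment> \<open>The renaming becomes an update: \<open>x\<close> now takes the value of
      \<open>y\<close>, the last projection.\<close>
    also have "\<dots> = sem u (pow M D (Suc ?k)) ((ctxt_env (\<Gamma> @ [y]))(x := ctxt_env (\<Gamma> @ [y]) y))"
      using sem_subst[OF env'] by simp
    finally have "pow_snoc M D ?k ;; interp M (u[x ::= Var y]) (\<Gamma> @ [y])
        = pow_snoc M D ?k ;;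
          sem u (pow M D (Suc ?k)) ((ctxt_env (\<Gamma> @ [y]))(x := ctxt_env (\<Gamma> @ [y]) y))"
      by simp
    \<comment> \<open>Naturality along \<open>pow_snoc\<close> passes from the stage
      \<open>pow M D (Suc ?k)\<close> to \<open>prod2 M ?X D\<close>, the stage at which
      \<open>sem\<close> reads the body.\<close>
    also have "\<dots> = sem u (prod2 M ?X D)
        (\<lambda>v. pow_snoc M D ?k ;; ((ctxt_env (\<Gamma> @ [y]))(x := ctxt_env (\<Gamma> @ [y]) y)) v)"
      using seq_sem[of "pow M D (Suc ?k)" _ "pow_snoc M D ?k"] env' snoc by (simp add: env_def)
    \<comment> \<open>Agreement is claimed only on the free variables of \<open>u\<close>: a renamed
      \<open>y\<close> differs from \<open>x\<close> and lies outside \<open>\<Gamma>\<close>, so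
      the two valuations treat it differently.\<close>
    also have "\<dots> = sem u (prod2 M ?X D) ?\<rho>"
    proof (rule sem_cong)
      fix v assume v: "v \<in> FV u"
      show "pow_snoc M D ?k ;; ((ctxt_env (\<Gamma> @ [y]))(x := ctxt_env (\<Gamma> @ [y]) y)) v = ?\<rho> v"
      proof (cases "v = x")
        case True
        have "ctxt_env (\<Gamma> @ [y]) y = pow_proj M D (Suc ?k) ?k"
          using ctxt_env_nth[OF dist, of ?k] by simp
        with True show ?thesis
          by (simp add: pow_snoc_proj_last)
      next
        case False
        then have "v \<in> set \<Gamma>"
          using v less.prems Lam by auto
        then obtain i where i: "i < ?k" "v = \<Gamma> ! i"
          by (auto simp: in_set_conv_nth)
        then have "ctxt_env (\<Gamma> @ [y]) v = pow_proj M D (Suc ?k) i"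
          using ctxt_env_nth[OF dist, of i] by (simp add: nth_append)
        with False i less.prems show ?thesis
          by (simp add: pow_snoc_proj ctxt_env_nth)
      qed
    qed
    finally show ?thesis
      using Lam by (simp add: Let_def y_def[symmetric] D_def[symmetric] dlam_def)
  next
    case (Con c)
    with less.prems show ?thesis
      by (simp add: D_def lc_terms_def)
  next
    case (Case \<theta> u)
    have u: "u \<in> lc_terms n"
      using less.prems Case by (simp add: lc_terms_def)
    have arg: "interp M u \<Gamma> = sem u ?X (ctxt_env \<Gamma>)"
      by (rule less.IH) (use less.prems Case u size_case_arg FV_Case in auto)
    have "(case fmlookup \<theta> i of Some w \<Rightarrow> interp M w \<Gamma> | None \<Rightarrow> bang M ?X ;; failM M)
        = branch \<theta> ?X (ctxt_env \<Gamma>) i" for i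
    proof (cases "fmlookup \<theta> i")
      case (Some w)
      have "interp M w \<Gamma> = sem w ?X (ctxt_env \<Gamma>)"
      proof (rule less.IH)
        show "size w < size t"
          using size_fmlookup[OF Some] Case by simp
        show "FV w \<subseteq> set \<Gamma>"
          using FV_cb_lookup[OF Some] less.prems Case FV_Case by blast
        show "w \<in> lc_terms n"
          using constrs_lookup[OF Some, of u] less.prems Case by (auto simp only: lc_terms_def)
      qed (use less.prems in auto)
      with Some show ?thesis
        by (simp add: branch_def)
    qed (simp add: branch_def)
    with arg Case show ?thesis
      by (simp add: Let_def sem_Case sem_cb_def dcase_def D_def[symmetric] n_def[symmetric])
  qed
qed

lemma interp_sound:
  assumes "distinct \<Gamma>" "t \<in> lc_terms n" "FV t \<subseteq> set \<Gamma>" "t' \<in> lc_terms n" "FV t' \<subseteq> set \<Gamma>"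
    "lc_conv n t t'"
  shows "interp M t \<Gamma> = interp M t' \<Gamma>"
  using assms interp_eq_sem sem_lc_conv[OF assms(6) env_ctxt_env] by simp

end

theorem theorem1:
  fixes M :: "('o, 'a) lc_model"
    and \<Gamma> :: "var list"
    and t t' :: trm
  assumes "lambdaC_model M"
    and "distinct \<Gamma>"
    and "t \<in> lc_terms (ncon M)" and "FV t \<subseteq> set \<Gamma>"
    and "t' \<in> lc_terms (ncon M)" and "FV t' \<subseteq> set \<Gamma>"
    and "lc_conv (ncon M) t t'"
  shows "interp M t \<Gamma> = interp M t' \<Gamma>"
  \<comment> \<open>Outside the locale the locally defined \<open>n\<close> becomes
    \<open>ncon M\<close>.\<close>
  by (rule lambdaC_model.interp_sound[OF assms])

end
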